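(* Let $\alpha\in(0,1]$, $T>0$, let $V,W,U$ be finite-dimensional Banach spaces and $\mathbf X=(X,\mathbb X)\in\mathscr C^{\alpha;1+\alpha}([0,T];V)$. Let $\mathcal Y=(Y,Y',Y'',\dot Y)\in\mathscr D^{3\alpha}_{\mathbf X}([0,T];W)$ and $\mathcal F=(F,F',\partial F,F'',\partial F',\partial^2F,\dot F)\in\mathscr D^{3\alpha}_{\mathbf X}\mathrm{Lip}^3_{x,\mathrm{loc}}(W;U)$. Define $$\begin{aligned} Z_t&:=F_t(Y_t),\qquad Z_t':=F_t'(Y_t)+\partial F_t(Y_t)Y_t',\\ Z_t''&:=\partial F_t(Y_t)Y_t''+F_t''(Y_t)+\partial F_t'(Y_t)Y_t'+(\partial F_t'(Y_t)Y_t')^\top+\partial^2F_t(Y_t)(Y_t',Y_t'),\\ \dot Z_t&:=\partial F_t(Y_t)\dot Y_t+\dot F_t(Y_t)+\Big(\partial F_t'(Y_t)Y_t'+\tfrac12\partial^2F_t(Y_t)(Y_t',Y_t')\Big)\dot{[\mathbf X]}_t . \end{aligned}$$ Then $\mathcal Z=(Z,Z',Z'',\dot Z)\in\mathscr D^{3\alpha}_{\mathbf X}([0,T];U)$.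
   Context: Notation. $\Delta_T=\{(s,t):0\le s<t\le T\}$, $\delta X_{s,t}=X_t-X_s$. $\mathcal L(V;U)$ is the space of linear maps and $\mathcal S(W^{\otimes2};U)\subset\mathcal L(W^{\otimes 2};U)$ the symmetric ones. $\mathcal L(E_1;\mathcal L(E_2;U))$ is identified with $\mathcal L(E_1\otimes E_2;U)$; for $A\in\mathcal L(E_1\otimes E_2;U)$ and $e_1\in E_1$, $Ae_1\in\mathcal L(E_2;U)$ is $e_2\mapsto A(e_1\otimes e_2)$, and $A^\top(e_2\otimes e_1)=A(e_1\otimes e_2)$. $\partial F_t'(Y_t)Y_t'\in\mathcal L(V\otimes V;U)$ is $v_1\otimes v_2\mapsto\partial F'_t(Y_t)(Y_t'v_1\otimes v_2)$, and $\partial^2F_t(Y_t)(Y_t',Y_t')$ is $v_1\otimes v_2\mapsto\partial^2F_t(Y_t)(Y_t'v_1\otimes Y_t'v_2)$; in $\dot Z$ such maps are applied to $\dot{[\mathbf X]}_t\in V\otimes V$. Rough paths. $\mathscr C^{\alpha}([0,T];V)$ is the set of $\mathbf X=(X,\mathbb X)$ with $X:[0,T]\to V$ $\alpha$-Hölder, $\mathbb X:\Delta_T\to V\otimes V$ with $\sup|\mathbb X_{s,t}|/|t-s|^{2\alpha}<\infty$ and $\mathbb X_{s,t}-\mathbb X_{s,u}-\mathbb X_{u,t}=\delta X_{s,u}\otimes\delta X_{u,t}$ for $s<u<t$. The bracket is $[\mathbf X]_{s,t}=\delta X_{s,t}\otimes\delta X_{s,t}-2\,\mathrm{Sym}(\mathbb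 X_{s,t})$, the increment of the path $[\mathbf X]_t:=[\mathbf X]_{0,t}$. $\mathscr C^{\alpha;1+\alpha}$: those $\mathbf X$ for which $t\mapsto[\mathbf X]_t$ is continuously differentiable with $\alpha$-Hölder derivative $\dot{[\mathbf X]}$. Strongly controlled rough paths. $\mathscr D^{3\alpha}_{\mathbf X}([0,T];W)$ is the set of $(Y,Y',Y'',\dot Y):[0,T]\to W\times\mathcal L(V;W)\times\mathcal L(V^{\otimes2};W)\times W$ such that, for some $C$ and all $(s,t)\in\Delta_T$: $|\delta Y_{s,t}-Y'_s\delta X_{s,t}-Y''_s\mathbb X_{s,t}-\dot Y_s(t-s)|\le C|t-s|^{3\alpha}$, $|\delta Y'_{s,t}-Y''_s\delta X_{s,t}|\le C|t-s|^{2\alpha}$, $|\delta Y''_{s,t}|+|\delta\dot Y_{s,t}|\le C|t-s|^\alpha$. Controlled fields. For $\mathfrak K\subset W$ compact and expressions $A,B$ depending on $t_0\le t_1$ in $[0,T]$ and $x_0,x_1\in\mathfrak K$, write $A\stackrel{k}{=}B$ if $|A-B|\le C(|t_1-t_0|^{\alpha}\vee|x_1-x_0|)^k$ for a constant $C$ (depending on $\mathfrak K$) and all such $t_0,t_1,x_0,x_1$. $\mathscr D^{3\alpha}_{\mathbf X}\mathrm{Lip}^3_{x,\mathrm{loc}}(W;U)$ is the set of $7$-tuples $(F,F',\partial F,F'',\partial F',\partial^2F,\dot F)$ of functions on $[0,T]\times W$ with values in $U$, $\mathcal L(V;U)$, $\mathcal L(W;U)$, $\mathcal L(V^{\otimes2};U)$,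 $\mathcal L(W\otimes V;U)$, $\mathcal S(W^{\otimes2};U)$, $U$ respectively such that for every compact $\mathfrak K\subset W$, with $\Delta x=x_1-x_0$ and coefficients on the right evaluated at $(t_0,x_0)$, $$F_{t_1}(x_1)\stackrel3=F+F'\delta X_{t_0,t_1}+\partial F\Delta x+F''\mathbb X_{t_0,t_1}+\partial F'(\Delta x\otimes\delta X_{t_0,t_1})+\tfrac12\partial^2F(\Delta x)^{\otimes2}+\dot F(t_1-t_0),$$ $$F'_{t_1}(x_1)\stackrel2=F'+F''\delta X_{t_0,t_1}+\partial F'\Delta x,\qquad \partial F_{t_1}(x_1)\stackrel2=\partial F+(\partial F')^\top\delta X_{t_0,t_1}+\partial^2F\Delta x,$$ $$G_{t_1}(x_1)\stackrel1=G_{t_0}(x_0)\quad\text{for }G\in\{F'',\partial F',\partial^2F,\dot F\}.$$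
   Formalization: The exponent is restricted to α in (0,1/2], since for each α in (1/2,1] the claim is false: X=0, 𝕏=0, Y_t=t, Ẏ=1, F=0, F'_t(x)v=xv, ∂F'(x⊗v)=xv (all else 0) give Z'_t=t, Z''=0, and |t−s| is not O(|t−s|^{2α}). *)

theory Defs
  imports "HOL-Analysis.Analysis"
begin

section \<open>Finite-dimensional Banach spaces\<close>

text \<open>The norm is arbitrary (not necessarily Euclidean). On such spaces every linear map is bounded,
  so \<open>'a \<Rightarrow>\<^sub>L 'b\<close> is the space of all linear maps.\<close>

class finite_dim_banach = banach +
  assumes finite_generators: "\<exists>B. finite B \<and> (\<forall>v. \<exists>c. v = (\<Sum>b\<in>B. c b *\<^sub>R b))"

lemma finite_spanning_set: "\<exists>B :: 'a::finite_dim_banach set. finite B \<and> span B = UNIV"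
proof -
  obtain B :: "'a set" where B: "finite B" "\<And>v. \<exists>c. v = (\<Sum>b\<in>B. c b *\<^sub>R b)"
    using finite_generators by blast
  have "v \<in> span B" for v
  proof -
    obtain c where "v = (\<Sum>b\<in>B. c b *\<^sub>R b)" using B(2) by blast
    then show ?thesis by (simp only:) (intro span_sum span_scale span_base)
  qed
  then show ?thesis using B(1) by auto
qed

instance real :: finite_dim_banach
  by standard (auto intro!: exI[of _ "{1}"])

lemma coefficients_bounded:
  fixes B :: "'a::real_normed_vector set"
  assumes "finite B" "independent B"
  shows "\<exists>c. c \<ge> 0 \<and> (\<forall>a. (\<Sum>b\<in>B. \<bar>a b\<bar>) \<le> c * norm (\<Sum>b\<in>B. a b *\<^sub>R b))"
  using assms
proof (induction B rule: finite_induct)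
  case empty
  then show ?case by auto
next
  case (insert x B)
  have indB: "independent B" and xB: "x \<notin> span B"
    using insert.prems insert.hyps by (auto simp: independent_insert)
  then obtain K where K: "K \<ge> 0" "\<And>a. (\<Sum>b\<in>B. \<bar>a b\<bar>) \<le> K * norm (\<Sum>b\<in>B. a b *\<^sub>R b)"
    using insert.IH by blast
  have "closed (span B)"
    unfolding closed_sequential_limits
  proof (intro allI impI)
    fix u l assume ul: "(\<forall>n. u n \<in> span B) \<and> u \<longlonglongrightarrow> l"
    have "\<forall>n. \<exists>a. u n = (\<Sum>b\<in>B. a b *\<^sub>R b)"
      using ul \<open>finite B\<close> by (auto simp: span_finite)
    then obtain a where a: "\<And>n. u n = (\<Sum>b\<in>B. a n b *\<^sub>R b)" by metis
    have cau: "Cauchy u" using ul LIMSEQ_imp_Cauchy by blast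
    have "convergent (\<lambda>n. a n b)" if b: "b \<in> B" for b
    proof -
      have le: "\<bar>a m b - a n b\<bar> \<le> K * norm (u m - u n)" for m n
      proof -
        have "\<bar>a m b - a n b\<bar> \<le> (\<Sum>b\<in>B. \<bar>a m b - a n b\<bar>)"
          using b \<open>finite B\<close> by (intro member_le_sum) auto
        also have "\<dots> \<le> K * norm (\<Sum>b\<in>B. (a m b - a n b) *\<^sub>R b)" by (rule K(2))
        also have "(\<Sum>b\<in>B. (a m b - a n b) *\<^sub>R b) = u m - u n"
          by (simp add: a scaleR_left_diff_distrib sum_subtractf)
        finally show ?thesis .
      qed
      have "Cauchy (\<lambda>n. a n b)"
      proof (rule CauchyI)
        fix e :: real assume e: "e > 0"
        have "e / (K + 1) > 0" using e K(1) by simp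
        then obtain M where M: "\<And>m n. m \<ge> M \<Longrightarrow> n \<ge> M \<Longrightarrow> norm (u m - u n) < e / (K + 1)"
          using CauchyD[OF cau] by blast
        show "\<exists>M. \<forall>m\<ge>M. \<forall>n\<ge>M. norm (a m b - a n b) < e"
        proof (intro exI allI impI)
          fix m n assume mn: "M \<le> m" "M \<le> n"
          have "norm (a m b - a n b) \<le> K * norm (u m - u n)" using le by simp
          also have "\<dots> \<le> (K + 1) * norm (u m - u n)" by (simp add: mult_right_mono)
          also have "\<dots> < (K + 1) * (e / (K + 1))"
            using M[OF mn] K(1) by (intro mult_strict_left_mono) auto
          also have "\<dots> = e" using K(1) by simp
          finally show "norm (a m b - a n b) < e" .
        qed
      qed
      then show ?thesis by (simp add: real_Cauchy_convergent)
    qed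
    then have lim: "(\<lambda>n. a n b) \<longlonglongrightarrow> lim (\<lambda>n. a n b)" if "b \<in> B" for b
      using that by (simp add: convergent_LIMSEQ_iff)
    have "u \<longlonglongrightarrow> (\<Sum>b\<in>B. lim (\<lambda>n. a n b) *\<^sub>R b)"
      unfolding a by (intro tendsto_sum tendsto_scaleR lim tendsto_const)
    then have "l = (\<Sum>b\<in>B. lim (\<lambda>n. a n b) *\<^sub>R b)"
      using ul LIMSEQ_unique by blast
    then show "l \<in> span B" by (simp only:) (intro span_sum span_scale span_base)
  qed
  then have d: "infdist x (span B) > 0" (is "?d > 0")
    using xB by (intro infdist_pos_not_in_closed) (auto intro: span_zero)
  let ?c = "1 / ?d + K * (1 + norm x / ?d)"
  show ?case
  proof (intro exI[of _ ?c] conjI allI)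
    show "?c \<ge> 0" using d K(1) by simp
    fix a :: "'a \<Rightarrow> real"
    let ?u = "\<Sum>b\<in>B. a b *\<^sub>R b" and ?v = "\<Sum>b\<in>insert x B. a b *\<^sub>R b"
    have v: "?v = a x *\<^sub>R x + ?u" using insert.hyps by simp
    have uin: "?u \<in> span B" by (intro span_sum span_scale span_base)
    have ax: "\<bar>a x\<bar> * ?d \<le> norm ?v"
    proof (cases "a x = 0")
      case False
      have "?d \<le> dist x ((- 1 / a x) *\<^sub>R ?u)"
        using uin by (intro infdist_le span_scale)
      also have "\<dots> = norm ((1 / a x) *\<^sub>R ?v)"
        using False by (simp add: v dist_norm scaleR_right_distrib)
      also have "\<dots> = norm ?v / \<bar>a x\<bar>" by simp
      finally show ?thesis using False by (simp add: pos_le_divide_eq mult.commute)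
    qed auto
    then have ax': "\<bar>a x\<bar> \<le> norm ?v / ?d" using d by (simp add: pos_le_divide_eq)
    have "norm ?u \<le> norm ?v + \<bar>a x\<bar> * norm x"
      using norm_triangle_ineq4[of ?v "a x *\<^sub>R x"] unfolding v by simp
    also have "\<dots> \<le> norm ?v + norm ?v / ?d * norm x"
      using ax' by (intro add_left_mono mult_right_mono) auto
    finally have "K * norm ?u \<le> K * (norm ?v + norm ?v / ?d * norm x)"
      using K(1) by (rule mult_left_mono)
    then have "(\<Sum>b\<in>B. \<bar>a b\<bar>) \<le> K * (norm ?v + norm ?v / ?d * norm x)"
      using K(2)[of a] by linarith
    then have "(\<Sum>b\<in>insert x B. \<bar>a b\<bar>) \<le> norm ?v / ?d + K * (norm ?v + norm ?v / ?d * norm x)"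
      using ax' insert.hyps by simp
    also have "\<dots> = ?c * norm ?v" by (simp add: algebra_simps add_divide_distrib)
    finally show "(\<Sum>b\<in>insert x B. \<bar>a b\<bar>) \<le> ?c * norm ?v" .
  qed
qed

lemma coordinate_functionals:
  "\<exists>(B :: 'a::finite_dim_banach set) (\<phi> :: 'a \<Rightarrow> 'a \<Rightarrow>\<^sub>L real).
     finite B \<and> (\<forall>v. v = (\<Sum>b\<in>B. blinfun_apply (\<phi> b) v *\<^sub>R b))"
proof -
  obtain S :: "'a set" where S: "finite S" "span S = UNIV" using finite_spanning_set by blast
  obtain B where B: "B \<subseteq> S" "independent B" "S \<subseteq> span B"
    using maximal_independent_subset[of S] by blast
  have fin: "finite B" using B S finite_subset by blast
  have sp: "span B = UNIV"
    using S(2) span_mono[OF B(3)] by (auto simp: span_span)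
  let ?r = "representation B"
  have rep: "v = (\<Sum>b\<in>B. ?r v b *\<^sub>R b)" for v
    using sum_representation_eq[OF B(2) _ fin order_refl, of v] sp by simp
  obtain c where c: "\<And>a. (\<Sum>b\<in>B. \<bar>a b\<bar>) \<le> c * norm (\<Sum>b\<in>B. a b *\<^sub>R b)"
    using coefficients_bounded[OF fin B(2)] by blast
  have bl: "bounded_linear (\<lambda>v. ?r v b)" if b: "b \<in> B" for b
  proof (rule bounded_linear_intro)
    show "?r (x + y) b = ?r x b + ?r y b" for x y
      using representation_add[OF B(2)] sp by simp
    show "?r (r *\<^sub>R x) b = r *\<^sub>R ?r x b" for r x
      using representation_scale[OF B(2)] sp by simp
    fix x
    have "\<bar>?r x b\<bar> \<le> (\<Sum>b\<in>B. \<bar>?r x b\<bar>)" using b fin by (intro member_le_sum) auto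
    also have "\<dots> \<le> c * norm x" using c[of "?r x"] by (simp only: rep[symmetric])
    finally show "norm (?r x b) \<le> norm x * c" by (simp add: mult.commute)
  qed
  have "v = (\<Sum>b\<in>B. blinfun_apply (Blinfun (\<lambda>v. ?r v b)) v *\<^sub>R b)" for v
    by (rule trans[OF rep]) (simp add: bounded_linear_Blinfun_apply bl)
  then show ?thesis
    by (intro exI[of _ B] exI[of _ "\<lambda>b. Blinfun (\<lambda>v. ?r v b)"] conjI allI fin)
qed


section \<open>Tensor products\<close>

text \<open>For finite-dimensional spaces \<open>E \<otimes> E'\<close> is realised as the dual of the space of
  bilinear forms on \<open>E \<times> E'\<close>; the operator norm is then the projective tensor norm. That this
  is a tensor product is the content of \<open>span_tens\<close> and \<open>tensor_universal\<close> below.\<close>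

type_synonym ('a, 'b) tensor = "('a \<Rightarrow>\<^sub>L 'b \<Rightarrow>\<^sub>L real) \<Rightarrow>\<^sub>L real"

definition tens :: "'a::real_normed_vector \<Rightarrow> 'b::real_normed_vector \<Rightarrow> ('a, 'b) tensor"
    (infixl "\<otimes>" 70) where
  "v \<otimes> w = Blinfun (\<lambda>\<beta>. blinfun_apply (blinfun_apply \<beta> v) w)"

lemma tens_apply [simp]: "blinfun_apply (v \<otimes> w) \<beta> = blinfun_apply (blinfun_apply \<beta> v) w"
  unfolding tens_def by (subst bounded_linear_Blinfun_apply) (auto intro!: bounded_linear_intros)

lemma bounded_bilinear_tens: "bounded_bilinear (\<otimes>)"
proof
  fix a a' :: 'a and b b' :: 'b and r :: real
  show "(a + a') \<otimes> b = a \<otimes> b + a' \<otimes> b" "a \<otimes> (b + b') = a \<otimes> b + a \<otimes> b'"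
    "(r *\<^sub>R a) \<otimes> b = r *\<^sub>R (a \<otimes> b)" "a \<otimes> (r *\<^sub>R b) = r *\<^sub>R (a \<otimes> b)"
    by (auto intro!: blinfun_eqI simp: blinfun.bilinear_simps)
next
  have "norm ((a :: 'a) \<otimes> (b :: 'b)) \<le> norm a * norm b * 1" for a b
  proof (rule norm_blinfun_bound)
    fix \<beta> :: "'a \<Rightarrow>\<^sub>L 'b \<Rightarrow>\<^sub>L real"
    have "norm (blinfun_apply (blinfun_apply \<beta> a) b) \<le> norm (blinfun_apply \<beta> a) * norm b"
      by (rule norm_blinfun)
    also have "\<dots> \<le> norm \<beta> * norm a * norm b"
      by (intro mult_right_mono norm_blinfun) auto
    finally show "norm (blinfun_apply (a \<otimes> b) \<beta>) \<le> norm a * norm b * 1 * norm \<beta>"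
      by (simp add: mult_ac)
  qed auto
  then show "\<exists>K. \<forall>a b. norm ((a :: 'a) \<otimes> (b :: 'b)) \<le> norm a * norm b * K" by blast
qed

definition form_prod :: "('a::real_normed_vector \<Rightarrow>\<^sub>L real) \<Rightarrow> ('b::real_normed_vector \<Rightarrow>\<^sub>L real) \<Rightarrow>
    'a \<Rightarrow>\<^sub>L 'b \<Rightarrow>\<^sub>L real" where
  "form_prod \<phi> \<psi> = Blinfun (\<lambda>v. blinfun_apply \<phi> v *\<^sub>R \<psi>)"

lemma form_prod_apply [simp]:
  "blinfun_apply (blinfun_apply (form_prod \<phi> \<psi>) v) w = blinfun_apply \<phi> v * blinfun_apply \<psi> w"
  unfolding form_prod_def
  by (subst bounded_linear_Blinfun_apply) (auto intro!: bounded_linear_intros simp: blinfun.bilinear_simps)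

lemma tensor_expansion:
  fixes B :: "'a::real_normed_vector set" and C :: "'b::real_normed_vector set"
  assumes B: "\<And>v. v = (\<Sum>b\<in>B. blinfun_apply (\<phi> b) v *\<^sub>R b)"
    and C: "\<And>w. w = (\<Sum>c\<in>C. blinfun_apply (\<psi> c) w *\<^sub>R c)"
  shows "\<tau> = (\<Sum>b\<in>B. \<Sum>c\<in>C. blinfun_apply \<tau> (form_prod (\<phi> b) (\<psi> c)) *\<^sub>R (b \<otimes> c))"
proof (rule blinfun_eqI)
  fix \<beta> :: "'a \<Rightarrow>\<^sub>L 'b \<Rightarrow>\<^sub>L real"
  let ?\<beta> = "\<Sum>b\<in>B. \<Sum>c\<in>C. blinfun_apply (blinfun_apply \<beta> b) c *\<^sub>R form_prod (\<phi> b) (\<psi> c)"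
  have "\<beta> = ?\<beta>"
  proof (intro blinfun_eqI)
    fix v w
    have "blinfun_apply (blinfun_apply \<beta> v) w =
        blinfun_apply (blinfun_apply \<beta> (\<Sum>b\<in>B. blinfun_apply (\<phi> b) v *\<^sub>R b))
          (\<Sum>c\<in>C. blinfun_apply (\<psi> c) w *\<^sub>R c)"
      by (simp only: B[symmetric] C[symmetric])
    also have "\<dots> = blinfun_apply (blinfun_apply ?\<beta> v) w"
      by (simp add: blinfun.bilinear_simps sum_distrib_left sum_distrib_right mult_ac)
        (rule sum.swap)
    finally show "blinfun_apply (blinfun_apply \<beta> v) w = blinfun_apply (blinfun_apply ?\<beta> v) w" .
  qed
  then have "blinfun_apply \<tau> \<beta> = blinfun_apply \<tau> ?\<beta>" by simp
  then show "blinfun_apply \<tau> \<beta> =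
      blinfun_apply (\<Sum>b\<in>B. \<Sum>c\<in>C. blinfun_apply \<tau> (form_prod (\<phi> b) (\<psi> c)) *\<^sub>R (b \<otimes> c)) \<beta>"
    by (simp add: blinfun.bilinear_simps mult_ac)
qed

lemma span_tens:
  "span (range (\<lambda>(v, w). v \<otimes> w)) = (UNIV :: ('a::finite_dim_banach, 'b::finite_dim_banach) tensor set)"
proof -
  obtain B :: "'a set" and \<phi> where B: "\<And>v. v = (\<Sum>b\<in>B. blinfun_apply (\<phi> b) v *\<^sub>R b)"
    using coordinate_functionals by blast
  obtain C :: "'b set" and \<psi> where C: "\<And>w. w = (\<Sum>c\<in>C. blinfun_apply (\<psi> c) w *\<^sub>R c)"
    using coordinate_functionals by blast
  have "\<tau> \<in> span (range (\<lambda>(v, w). v \<otimes> w))" for \<tau> :: "('a, 'b) tensor"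
    by (subst tensor_expansion[OF B C, of \<tau>], intro span_sum span_scale span_base) auto
  then show ?thesis by auto
qed

lemma tensor_maps_eqI:
  fixes A A' :: "('a::finite_dim_banach, 'b::finite_dim_banach) tensor \<Rightarrow>\<^sub>L 'c::real_normed_vector"
  assumes "\<And>v w. blinfun_apply A (v \<otimes> w) = blinfun_apply A' (v \<otimes> w)"
  shows "A = A'"
proof (rule blinfun_eqI)
  fix \<tau> :: "('a, 'b) tensor"
  have lin: "linear (blinfun_apply A)" "linear (blinfun_apply A')"
    by (auto intro: bounded_linear.linear blinfun.bounded_linear_right)
  have "\<tau> \<in> span (range (\<lambda>(v, w). v \<otimes> w))" by (simp add: span_tens)
  then show "blinfun_apply A \<tau> = blinfun_apply A' \<tau>"
    by (rule linear_eq_on_span[OF lin, rotated]) (auto simp: assms)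
qed

lemma tensor_universal:
  fixes \<beta> :: "'a::finite_dim_banach \<Rightarrow> 'b::finite_dim_banach \<Rightarrow> 'c::real_normed_vector"
  assumes "bounded_bilinear \<beta>"
  shows "\<exists>!A :: ('a, 'b) tensor \<Rightarrow>\<^sub>L 'c. \<forall>v w. blinfun_apply A (v \<otimes> w) = \<beta> v w"
proof (rule ex_ex1I)
  interpret \<beta>: bounded_bilinear \<beta> by fact
  obtain B :: "'a set" and \<phi> where B: "\<And>v. v = (\<Sum>b\<in>B. blinfun_apply (\<phi> b) v *\<^sub>R b)"
    using coordinate_functionals by blast
  obtain C :: "'b set" and \<psi> where C: "\<And>w. w = (\<Sum>c\<in>C. blinfun_apply (\<psi> c) w *\<^sub>R c)"
    using coordinate_functionals by blast
  define A where "A = (\<lambda>\<tau> :: ('a, 'b) tensor.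
    \<Sum>b\<in>B. \<Sum>c\<in>C. blinfun_apply \<tau> (form_prod (\<phi> b) (\<psi> c)) *\<^sub>R \<beta> b c)"
  have bl: "bounded_linear A"
    unfolding A_def by (intro bounded_linear_sum bounded_linear_intros)
  have "blinfun_apply (Blinfun A) (v \<otimes> w) = \<beta> v w" for v w
  proof -
    have "\<beta> v w = \<beta> (\<Sum>b\<in>B. blinfun_apply (\<phi> b) v *\<^sub>R b) (\<Sum>c\<in>C. blinfun_apply (\<psi> c) w *\<^sub>R c)"
      by (simp only: B[symmetric] C[symmetric])
    also have "\<dots> = A (v \<otimes> w)"
      by (simp add: A_def \<beta>.sum_left \<beta>.sum_right \<beta>.scaleR_left \<beta>.scaleR_right scaleR_sum_right
          mult.commute) (rule sum.swap)
    finally show ?thesis by (simp add: bounded_linear_Blinfun_apply bl)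
  qed
  then show "\<exists>A. \<forall>v w. blinfun_apply A (v \<otimes> w) = \<beta> v w" by blast
next
  fix A A' :: "('a, 'b) tensor \<Rightarrow>\<^sub>L 'c"
  assume "\<forall>v w. blinfun_apply A (v \<otimes> w) = \<beta> v w" "\<forall>v w. blinfun_apply A' (v \<otimes> w) = \<beta> v w"
  then show "A = A'" by (intro tensor_maps_eqI) simp
qed

text \<open>The linear map \<open>v \<otimes> w \<mapsto> \<beta> v w\<close> induced by a bilinear \<open>\<beta>\<close>.\<close>

definition tensor_lift :: "('a::finite_dim_banach \<Rightarrow> 'b::finite_dim_banach \<Rightarrow> 'c::real_normed_vector)
    \<Rightarrow> ('a, 'b) tensor \<Rightarrow>\<^sub>L 'c" where
  "tensor_lift \<beta> = (THE A. \<forall>v w. blinfun_apply A (v \<otimes> w) = \<beta> v w)"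

lemma tensor_lift_tens:
  assumes "bounded_bilinear \<beta>"
  shows "blinfun_apply (tensor_lift \<beta>) (v \<otimes> w) = \<beta> v w"
  using theI'[OF tensor_universal[OF assms]] unfolding tensor_lift_def by blast

text \<open>\<open>A e \<in> \<L>(E\<^sub>2;U)\<close> for \<open>A \<in> \<L>(E\<^sub>1 \<otimes> E\<^sub>2;U)\<close> and \<open>e \<in> E\<^sub>1\<close>.\<close>

definition partial_app :: "(('a::real_normed_vector, 'b::real_normed_vector) tensor \<Rightarrow>\<^sub>L 'c::real_normed_vector)
    \<Rightarrow> 'a \<Rightarrow> 'b \<Rightarrow>\<^sub>L 'c" where
  "partial_app A e = Blinfun (\<lambda>e'. blinfun_apply A (e \<otimes> e'))"

lemma partial_app_apply [simp]: "blinfun_apply (partial_app A e) e' = blinfun_apply A (e \<otimes> e')"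
  unfolding partial_app_def
  by (intro fun_cong[OF bounded_linear_Blinfun_apply]
      bounded_linear_compose[OF blinfun.bounded_linear_right]
      bounded_bilinear.bounded_linear_right[OF bounded_bilinear_tens])

definition tensor_transpose :: "(('a::finite_dim_banach, 'b::finite_dim_banach) tensor \<Rightarrow>\<^sub>L 'c::real_normed_vector)
    \<Rightarrow> ('b, 'a) tensor \<Rightarrow>\<^sub>L 'c" where
  "tensor_transpose A = tensor_lift (\<lambda>e' e. blinfun_apply A (e \<otimes> e'))"

definition symmetric_map :: "(('a::finite_dim_banach, 'a) tensor \<Rightarrow>\<^sub>L 'c::real_normed_vector) \<Rightarrow> bool" where
  "symmetric_map A \<longleftrightarrow> tensor_transpose A = A"

definition Sym :: "('a::finite_dim_banach, 'a) tensor \<Rightarrow> ('a, 'a) tensor" where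
  "Sym \<tau> = (1/2) *\<^sub>R (\<tau> + blinfun_apply (tensor_lift (\<lambda>v w. w \<otimes> v)) \<tau>)"

lemma bounded_bilinear_blinfun_tens:
  assumes "bounded_linear f" "bounded_linear g"
  shows "bounded_bilinear (\<lambda>v w. blinfun_apply A (f v \<otimes> g w))"
proof -
  interpret fg: bounded_bilinear "\<lambda>v w. f v \<otimes> g w"
    by (rule bounded_bilinear.comp[OF bounded_bilinear_tens assms])
  obtain K where K: "K > 0" "\<And>v w. norm (f v \<otimes> g w) \<le> norm v * norm w * K"
    using fg.pos_bounded by blast
  show ?thesis
  proof
    have "norm (blinfun_apply A (f v \<otimes> g w)) \<le> norm v * norm w * (norm A * K)" for v w
      using order_trans[OF norm_blinfun mult_left_mono[OF K(2) norm_ge_zero]] by (simp add: mult_ac)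
    then show "\<exists>K. \<forall>v w. norm (blinfun_apply A (f v \<otimes> g w)) \<le> norm v * norm w * K" by blast
  qed (simp_all add: fg.add_left fg.add_right fg.scaleR_left fg.scaleR_right blinfun.bilinear_simps)
qed


section \<open>Rough paths\<close>

definition hoelder_on :: "real \<Rightarrow> real \<Rightarrow> (real \<Rightarrow> 'a::real_normed_vector) \<Rightarrow> bool" where
  "hoelder_on \<alpha> T f \<longleftrightarrow> (\<exists>C. \<forall>s\<in>{0..T}. \<forall>t\<in>{0..T}. norm (f t - f s) \<le> C * \<bar>t - s\<bar> powr \<alpha>)"

text \<open>A rough path is a pair \<open>(X, XX)\<close>. The second component lives on \<open>0 \<le> s < t \<le> T\<close>; it is extended
  to the diagonal by \<open>XX t t = 0\<close> (the value forced by its Hoelder bound). The diagonal is used for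
  \<open>t\<^sub>0 = t\<^sub>1\<close> in the expansion of a controlled field and for the initial value of the bracket path.\<close>

definition rough_paths :: "real \<Rightarrow> real \<Rightarrow>
    ((real \<Rightarrow> 'v::finite_dim_banach) \<times> (real \<Rightarrow> real \<Rightarrow> ('v, 'v) tensor)) set" where
  "rough_paths \<alpha> T = {(X, XX).
     hoelder_on \<alpha> T X \<and>
     (\<exists>C. \<forall>s t. 0 \<le> s \<and> s < t \<and> t \<le> T \<longrightarrow> norm (XX s t) \<le> C * (t - s) powr (2 * \<alpha>)) \<and>
     (\<forall>t\<in>{0..T}. XX t t = 0) \<and>
     (\<forall>s u t. 0 \<le> s \<and> s < u \<and> u < t \<and> t \<le> T \<longrightarrow>
        XX s t - XX s u - XX u t = (X u - X s) \<otimes> (X t - X u))}"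

definition bracket :: "(real \<Rightarrow> 'v::finite_dim_banach) \<Rightarrow> (real \<Rightarrow> real \<Rightarrow> ('v, 'v) tensor) \<Rightarrow>
    real \<Rightarrow> real \<Rightarrow> ('v, 'v) tensor" where
  "bracket X XX s t = (X t - X s) \<otimes> (X t - X s) - 2 *\<^sub>R Sym (XX s t)"

definition bracket_path :: "(real \<Rightarrow> 'v::finite_dim_banach) \<Rightarrow> (real \<Rightarrow> real \<Rightarrow> ('v, 'v) tensor) \<Rightarrow>
    real \<Rightarrow> ('v, 'v) tensor" where
  "bracket_path X XX t = bracket X XX 0 t"

definition bracket_deriv :: "real \<Rightarrow> (real \<Rightarrow> 'v::finite_dim_banach) \<Rightarrow>
    (real \<Rightarrow> real \<Rightarrow> ('v, 'v) tensor) \<Rightarrow> real \<Rightarrow> ('v, 'v) tensor" where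
  "bracket_deriv T X XX t = vector_derivative (bracket_path X XX) (at t within {0..T})"

definition rough_paths_C1_bracket :: "real \<Rightarrow> real \<Rightarrow>
    ((real \<Rightarrow> 'v::finite_dim_banach) \<times> (real \<Rightarrow> real \<Rightarrow> ('v, 'v) tensor)) set" where
  "rough_paths_C1_bracket \<alpha> T = {(X, XX). (X, XX) \<in> rough_paths \<alpha> T \<and>
     (\<forall>t\<in>{0..T}. bracket_path X XX differentiable (at t within {0..T})) \<and>
     continuous_on {0..T} (bracket_deriv T X XX) \<and>
     hoelder_on \<alpha> T (bracket_deriv T X XX)}"


section \<open>Strongly controlled paths and controlled fields\<close>

definition strongly_controlled :: "real \<Rightarrow> real \<Rightarrow>
    (real \<Rightarrow> 'v::finite_dim_banach) \<Rightarrow> (real \<Rightarrow> real \<Rightarrow> ('v, 'v) tensor) \<Rightarrow>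
    ((real \<Rightarrow> 'w::finite_dim_banach) \<times> (real \<Rightarrow> 'v \<Rightarrow>\<^sub>L 'w) \<times> (real \<Rightarrow> ('v, 'v) tensor \<Rightarrow>\<^sub>L 'w) \<times>
      (real \<Rightarrow> 'w)) set" where
  "strongly_controlled \<alpha> T X XX = {(Y, Y', Y'', Yd). \<exists>C. \<forall>s t. 0 \<le> s \<and> s < t \<and> t \<le> T \<longrightarrow>
     norm (Y t - Y s - blinfun_apply (Y' s) (X t - X s) - blinfun_apply (Y'' s) (XX s t)
           - (t - s) *\<^sub>R Yd s) \<le> C * (t - s) powr (3 * \<alpha>) \<and>
     norm (Y' t - Y' s - partial_app (Y'' s) (X t - X s)) \<le> C * (t - s) powr (2 * \<alpha>) \<and>
     norm (Y'' t - Y'' s) + norm (Yd t - Yd s) \<le> C * (t - s) powr \<alpha>}"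

text \<open>\<open>A =\<^sub>k B\<close> on the compact set \<open>K\<close>; the arguments of \<open>A\<close> and \<open>B\<close> are \<open>t\<^sub>0, t\<^sub>1, x\<^sub>0, x\<^sub>1\<close>.\<close>

definition eq_to_order :: "real \<Rightarrow> real \<Rightarrow> 'w::real_normed_vector set \<Rightarrow> nat \<Rightarrow>
    (real \<Rightarrow> real \<Rightarrow> 'w \<Rightarrow> 'w \<Rightarrow> 'u::real_normed_vector) \<Rightarrow> (real \<Rightarrow> real \<Rightarrow> 'w \<Rightarrow> 'w \<Rightarrow> 'u) \<Rightarrow> bool" where
  "eq_to_order \<alpha> T K k A B \<longleftrightarrow> (\<exists>C. \<forall>t0 t1 x0 x1.
     0 \<le> t0 \<and> t0 \<le> t1 \<and> t1 \<le> T \<and> x0 \<in> K \<and> x1 \<in> K \<longrightarrow>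
     norm (A t0 t1 x0 x1 - B t0 t1 x0 x1) \<le> C * (max (\<bar>t1 - t0\<bar> powr \<alpha>) (norm (x1 - x0))) ^ k)"

definition controlled_fields :: "real \<Rightarrow> real \<Rightarrow>
    (real \<Rightarrow> 'v::finite_dim_banach) \<Rightarrow> (real \<Rightarrow> real \<Rightarrow> ('v, 'v) tensor) \<Rightarrow>
    ((real \<Rightarrow> 'w::finite_dim_banach \<Rightarrow> 'u::finite_dim_banach) \<times>
     (real \<Rightarrow> 'w \<Rightarrow> 'v \<Rightarrow>\<^sub>L 'u) \<times>
     (real \<Rightarrow> 'w \<Rightarrow> 'w \<Rightarrow>\<^sub>L 'u) \<times>
     (real \<Rightarrow> 'w \<Rightarrow> ('v, 'v) tensor \<Rightarrow>\<^sub>L 'u) \<times>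
     (real \<Rightarrow> 'w \<Rightarrow> ('w, 'v) tensor \<Rightarrow>\<^sub>L 'u) \<times>
     (real \<Rightarrow> 'w \<Rightarrow> ('w, 'w) tensor \<Rightarrow>\<^sub>L 'u) \<times>
     (real \<Rightarrow> 'w \<Rightarrow> 'u)) set" where
  "controlled_fields \<alpha> T X XX = {(F, F', dF, F'', dF', ddF, Fd).
     (\<forall>t\<in>{0..T}. \<forall>x. symmetric_map (ddF t x)) \<and>
     (\<forall>K. compact K \<longrightarrow>
       eq_to_order \<alpha> T K 3 (\<lambda>t0 t1 x0 x1. F t1 x1)
         (\<lambda>t0 t1 x0 x1. F t0 x0 + blinfun_apply (F' t0 x0) (X t1 - X t0)
            + blinfun_apply (dF t0 x0) (x1 - x0) + blinfun_apply (F'' t0 x0) (XX t0 t1)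
            + blinfun_apply (dF' t0 x0) ((x1 - x0) \<otimes> (X t1 - X t0))
            + (1/2) *\<^sub>R blinfun_apply (ddF t0 x0) ((x1 - x0) \<otimes> (x1 - x0))
            + (t1 - t0) *\<^sub>R Fd t0 x0) \<and>
       eq_to_order \<alpha> T K 2 (\<lambda>t0 t1 x0 x1. F' t1 x1)
         (\<lambda>t0 t1 x0 x1. F' t0 x0 + partial_app (F'' t0 x0) (X t1 - X t0)
            + partial_app (dF' t0 x0) (x1 - x0)) \<and>
       eq_to_order \<alpha> T K 2 (\<lambda>t0 t1 x0 x1. dF t1 x1)
         (\<lambda>t0 t1 x0 x1. dF t0 x0 + partial_app (tensor_transpose (dF' t0 x0)) (X t1 - X t0)
            + partial_app (ddF t0 x0) (x1 - x0)) \<and>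
       eq_to_order \<alpha> T K 1 (\<lambda>t0 t1 x0 x1. F'' t1 x1) (\<lambda>t0 t1 x0 x1. F'' t0 x0) \<and>
       eq_to_order \<alpha> T K 1 (\<lambda>t0 t1 x0 x1. dF' t1 x1) (\<lambda>t0 t1 x0 x1. dF' t0 x0) \<and>
       eq_to_order \<alpha> T K 1 (\<lambda>t0 t1 x0 x1. ddF t1 x1) (\<lambda>t0 t1 x0 x1. ddF t0 x0) \<and>
       eq_to_order \<alpha> T K 1 (\<lambda>t0 t1 x0 x1. Fd t1 x1) (\<lambda>t0 t1 x0 x1. Fd t0 x0))}"


section \<open>The range of the exponent\<close>

text \<open>Composition of strongly controlled paths with controlled fields cannot be expected for \<open>\<alpha> > 1/2\<close>:
  then \<open>t - s\<close> is no longer of order \<open>\<bar>t - s\<bar> powr (2 * \<alpha>)\<close>, and the drift of \<open>Y\<close> is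
  visible in \<open>Z'\<close>. With \<open>X = 0\<close>, \<open>Y t = t\<close>, \<open>F = 0\<close> and \<open>F' t x v = x * v\<close> one gets
  \<open>Z' t v = t * v\<close> but \<open>Z'' = 0\<close>.\<close>

lemma composition_fails_above_half:
  fixes \<alpha> T :: real
  assumes "1/2 < \<alpha>" "0 < T"
  shows "\<exists>(X :: real \<Rightarrow> real) XX (Y :: real \<Rightarrow> real) Y' Y'' Yd (F :: real \<Rightarrow> real \<Rightarrow> real) F' dF F'' dF' ddF Fd.
    (X, XX) \<in> rough_paths_C1_bracket \<alpha> T \<and>
    (Y, Y', Y'', Yd) \<in> strongly_controlled \<alpha> T X XX \<and>
    (F, F', dF, F'', dF', ddF, Fd) \<in> controlled_fields \<alpha> T X XX \<and>
    (let dF'Y' = (\<lambda>t. tensor_lift (\<lambda>v1 v2. blinfun_apply (dF' t (Y t)) (blinfun_apply (Y' t) v1 \<otimes> v2)));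
         ddFY'Y' = (\<lambda>t. tensor_lift (\<lambda>v1 v2. blinfun_apply (ddF t (Y t))
                      (blinfun_apply (Y' t) v1 \<otimes> blinfun_apply (Y' t) v2)))
     in (\<lambda>t. F t (Y t),
         \<lambda>t. F' t (Y t) + (dF t (Y t) o\<^sub>L Y' t),
         \<lambda>t. (dF t (Y t) o\<^sub>L Y'' t) + F'' t (Y t) + dF'Y' t + tensor_transpose (dF'Y' t) + ddFY'Y' t,
         \<lambda>t. blinfun_apply (dF t (Y t)) (Yd t) + Fd t (Y t)
              + blinfun_apply (dF'Y' t + (1/2) *\<^sub>R ddFY'Y' t) (bracket_deriv T X XX t))
        \<notin> strongly_controlled \<alpha> T X XX)"
proof -
  let ?X = "\<lambda>_. 0 :: real" and ?XX = "\<lambda>_ _. 0 :: (real, real) tensor"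
  let ?M = "tensor_lift (\<lambda>x v. x * v :: real)"
  have tens0 [simp]: "a \<otimes> 0 = 0" "0 \<otimes> a = 0" for a :: real
    by (auto intro!: blinfun_eqI simp: blinfun.bilinear_simps)
  have M [simp]: "blinfun_apply ?M (x \<otimes> v) = x * v" for x v
    by (rule tensor_lift_tens) (rule bounded_bilinear_mult)
  have pa0 [simp]: "partial_app A 0 = 0" for A :: "(real, real) tensor \<Rightarrow>\<^sub>L real"
    by (rule blinfun_eqI) simp
  have comp0 [simp]: "(0 :: real \<Rightarrow>\<^sub>L real) o\<^sub>L A = 0" for A :: "'c::real_normed_vector \<Rightarrow>\<^sub>L real"
    by (rule blinfun_eqI) simp
  have p0a [simp]: "partial_app (0 :: (real, real) tensor \<Rightarrow>\<^sub>L real) a = 0" for a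
    by (rule blinfun_eqI) simp
  have paM [simp]: "partial_app ?M x = x *\<^sub>R id_blinfun" for x
    by (rule blinfun_eqI) (simp add: blinfun.bilinear_simps)
  have lift0 [simp]: "tensor_lift (\<lambda>_ _. 0) = (0 :: (real, real) tensor \<Rightarrow>\<^sub>L real)"
    by (rule tensor_maps_eqI, subst tensor_lift_tens) (auto intro: bounded_bilinear.comp1 simp: bounded_bilinear_def exI[of _ 0])
  have tr0 [simp]: "tensor_transpose (0 :: (real, real) tensor \<Rightarrow>\<^sub>L real) = 0"
    by (simp add: tensor_transpose_def)
  have br [simp]: "bracket_path ?X ?XX = (\<lambda>_. 0)"
    by (auto simp: bracket_path_def bracket_def Sym_def fun_eq_iff)
  have bd: "bracket_deriv T ?X ?XX t = 0" if "t \<in> {0..T}" for t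
    unfolding bracket_deriv_def br
    using that assms by (intro vector_derivative_within) (auto simp: trivial_limit_within islimpt_Icc)
  have bc: "continuous_on {0..T} (bracket_deriv T ?X ?XX)"
    by (subst continuous_on_cong[OF refl bd]) auto
  have "(?X, ?XX) \<in> rough_paths_C1_bracket \<alpha> T"
    by (auto simp: rough_paths_C1_bracket_def rough_paths_def hoelder_on_def bd bc intro!: exI[of _ 0])
  moreover have "((\<lambda>t. t), \<lambda>_. 0, \<lambda>_. 0, \<lambda>_. 1 :: real) \<in> strongly_controlled \<alpha> T ?X ?XX"
    by (auto simp: strongly_controlled_def intro!: exI[of _ 0])
  moreover have "((\<lambda>_ _. 0 :: real), \<lambda>_ x. x *\<^sub>R id_blinfun, \<lambda>_ _. 0, \<lambda>_ _. 0, \<lambda>_ _. ?M, \<lambda>_ _. 0, \<lambda>_ _. 0)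
      \<in> controlled_fields \<alpha> T ?X ?XX"
    by (auto simp: controlled_fields_def symmetric_map_def eq_to_order_def scaleR_left_diff_distrib intro!: exI[of _ 0])
  moreover have "((\<lambda>t. 0 :: real), \<lambda>t. t *\<^sub>R id_blinfun, \<lambda>t. 0, Zd) \<notin> strongly_controlled \<alpha> T ?X ?XX" for Zd
  proof
    assume "((\<lambda>t. 0 :: real), \<lambda>t. t *\<^sub>R id_blinfun, \<lambda>t. 0, Zd) \<in> strongly_controlled \<alpha> T ?X ?XX"
    then obtain C where C: "\<And>s t. 0 \<le> s \<Longrightarrow> s < t \<Longrightarrow> t \<le> T \<Longrightarrow>
        norm (t *\<^sub>R id_blinfun - s *\<^sub>R (id_blinfun :: real \<Rightarrow>\<^sub>L real)) \<le> C * (t - s) powr (2 * \<alpha>)"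
      by (auto simp: strongly_controlled_def)
    have le: "1 \<le> C * t powr (2 * \<alpha> - 1)" if t: "0 < t" "t \<le> T" for t
    proof -
      have "t = norm (blinfun_apply (t *\<^sub>R id_blinfun) (1::real))"
        using t by (simp add: blinfun.bilinear_simps)
      also have "\<dots> \<le> norm (t *\<^sub>R (id_blinfun :: real \<Rightarrow>\<^sub>L real)) * norm (1::real)"
        by (rule norm_blinfun)
      also have "\<dots> \<le> C * t powr (2 * \<alpha>)" using C[of 0 t] t by simp
      finally show ?thesis using t by (simp add: powr_diff field_simps)
    qed
    have "((\<lambda>t. t powr (2 * \<alpha> - 1)) \<longlongrightarrow> 0 powr (2 * \<alpha> - 1)) (at_right (0::real))"
      using assms by (intro tendsto_powr' tendsto_const tendsto_ident_at)
        (auto simp: eventually_at_filter)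
    then have "((\<lambda>t. C * t powr (2 * \<alpha> - 1)) \<longlongrightarrow> C * 0) (at_right 0)"
      by (intro tendsto_mult tendsto_const) simp
    then have "\<forall>\<^sub>F t in at_right 0. C * t powr (2 * \<alpha> - 1) < 1"
      by (intro order_tendstoD(2)[where y = "C * 0"]) auto
    moreover have "\<forall>\<^sub>F t in at_right 0. t \<in> {0<..<T}"
      using assms by (intro eventually_at_right_real)
    ultimately have "\<forall>\<^sub>F t in at_right (0::real). False"
      by eventually_elim (use le in fastforce)
    then show False by simp
  qed
  ultimately show ?thesis
    by - (rule exI[of _ ?X], rule exI[of _ ?XX], rule exI[of _ "\<lambda>t. t"], rule exI[of _ "\<lambda>_. 0"],
        rule exI[of _ "\<lambda>_. 0"], rule exI[of _ "\<lambda>_. 1"], rule exI[of _ "\<lambda>_ _. 0"],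
        rule exI[of _ "\<lambda>_ x. x *\<^sub>R id_blinfun"], rule exI[of _ "\<lambda>_ _. 0"], rule exI[of _ "\<lambda>_ _. 0"],
        rule exI[of _ "\<lambda>_ _. ?M"], rule exI[of _ "\<lambda>_ _. 0"], rule exI[of _ "\<lambda>_ _. 0"], simp)
qed

end

theory Submission
  imports Defs
begin

text \<open>Taylor-expand \<open>F\<close> along \<open>Y\<close> and replace every \<open>\<delta>Y\<close> by \<open>Y' \<delta>X\<close>, except in the first-order
  term, where the full expansion of \<open>\<delta>Y\<close> is needed. The quadratic terms become
  \<open>(\<partial>F' Y' + \<partial>\<^sup>2F (Y', Y') / 2)(\<delta>X \<otimes> \<delta>X)\<close>, and \<open>\<delta>X \<otimes> \<delta>X\<close> is the bracket increment plus the
  symmetrised second level \<open>2 Sym XX\<close>: the former is \<open>(t - s)\<close> times the bracket derivative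
  up to order \<open>1 + \<alpha> \<ge> 3 \<alpha>\<close> and contributes to \<open>Zd\<close>, the latter contributes to \<open>Z''\<close>.\<close>

section \<open>Orders of two-parameter functions\<close>

text \<open>Remainder estimates become a calculus of exponents: sums keep the order and bilinear
  products add it. Only \<open>s < t\<close> is tested, as in
  \<open>strongly_controlled\<close>.\<close>

definition incr_order :: "real \<Rightarrow> real \<Rightarrow> (real \<Rightarrow> real \<Rightarrow> 'a::real_normed_vector) \<Rightarrow> bool" where
  "incr_order T r f \<longleftrightarrow> (\<exists>C. \<forall>s t. 0 \<le> s \<and> s < t \<and> t \<le> T \<longrightarrow> norm (f s t) \<le> C * (t - s) powr r)"

lemma incr_orderI:
  assumes "\<And>s t. 0 \<le> s \<Longrightarrow> s < t \<Longrightarrow> t \<le> T \<Longrightarrow> norm (f s t) \<le> C * (t - s) powr r"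
  shows "incr_order T r f"
  using assms unfolding incr_order_def by blast

lemma incr_orderE:
  assumes "incr_order T r f"
  obtains C where "C \<ge> 0" "\<And>s t. 0 \<le> s \<Longrightarrow> s < t \<Longrightarrow> t \<le> T \<Longrightarrow> norm (f s t) \<le> C * (t - s) powr r"
proof -
  obtain C where C: "\<And>s t. 0 \<le> s \<Longrightarrow> s < t \<Longrightarrow> t \<le> T \<Longrightarrow> norm (f s t) \<le> C * (t - s) powr r"
    using assms unfolding incr_order_def by blast
  show thesis
  proof (rule that[of "\<bar>C\<bar>"])
    show "norm (f s t) \<le> \<bar>C\<bar> * (t - s) powr r" if "0 \<le> s" "s < t" "t \<le> T" for s t
      by (rule order_trans[OF C[OF that]]) (simp add: mult_right_mono)
  qed simp
qed

lemma incr_order_cong: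
  assumes "\<And>s t. 0 \<le> s \<Longrightarrow> s < t \<Longrightarrow> t \<le> T \<Longrightarrow> f s t = g s t"
  shows "incr_order T r f \<longleftrightarrow> incr_order T r g"
  unfolding incr_order_def by (intro arg_cong[where f = Ex] ext all_cong) (simp add: assms)

lemma incr_order_add:
  assumes "incr_order T r f" "incr_order T r g"
  shows "incr_order T r (\<lambda>s t. f s t + g s t)"
proof -
  obtain C where C: "C \<ge> 0" "\<And>s t. 0 \<le> s \<Longrightarrow> s < t \<Longrightarrow> t \<le> T \<Longrightarrow> norm (f s t) \<le> C * (t - s) powr r"
    using incr_orderE[OF assms(1)] by blast
  obtain D where D: "D \<ge> 0" "\<And>s t. 0 \<le> s \<Longrightarrow> s < t \<Longrightarrow> t \<le> T \<Longrightarrow> norm (g s t) \<le> D * (t - s) powr r"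
    using incr_orderE[OF assms(2)] by blast
  show ?thesis
  proof (rule incr_orderI)
    fix s t assume "0 \<le> s" "s < t" "t \<le> T"
    then show "norm (f s t + g s t) \<le> (C + D) * (t - s) powr r"
      unfolding distrib_right by (intro norm_triangle_mono C(2) D(2))
  qed
qed

text \<open>Powers of \<open>t - s\<close> multiply by adding exponents, for any bounded bilinear
  pairing. One estimate thus covers application, composition, scaling, \<open>\<otimes>\<close>,
  \<open>partial_app\<close> and \<open>tensor_map\<close>.\<close>

lemma incr_order_bilinear:
  assumes "bounded_bilinear p" "incr_order T q f" "incr_order T r g"
  shows "incr_order T (q + r) (\<lambda>s t. p (f s t) (g s t))"
proof -
  obtain K where K: "K \<ge> 0" "\<And>a b. norm (p a b) \<le> norm a * norm b * K"
    using bounded_bilinear.nonneg_bounded[OF assms(1)] by blast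
  obtain C where C: "C \<ge> 0" "\<And>s t. 0 \<le> s \<Longrightarrow> s < t \<Longrightarrow> t \<le> T \<Longrightarrow> norm (f s t) \<le> C * (t - s) powr q"
    using incr_orderE[OF assms(2)] by blast
  obtain D where D: "D \<ge> 0" "\<And>s t. 0 \<le> s \<Longrightarrow> s < t \<Longrightarrow> t \<le> T \<Longrightarrow> norm (g s t) \<le> D * (t - s) powr r"
    using incr_orderE[OF assms(3)] by blast
  show ?thesis
  proof (rule incr_orderI)
    fix s t assume st: "0 \<le> s" "s < t" "t \<le> T"
    have "norm (p (f s t) (g s t)) \<le> norm (f s t) * norm (g s t) * K" by (rule K)
    also have "\<dots> \<le> (C * (t - s) powr q) * (D * (t - s) powr r) * K"
      using C D st K by (intro mult_right_mono mult_mono) auto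
    finally show "norm (p (f s t) (g s t)) \<le> (C * D * K) * (t - s) powr (q + r)"
      by (simp add: powr_add mult_ac)
  qed
qed

text \<open>On a bounded time interval the surplus factor \<open>(t - s) powr (r - q)\<close> is at
  most \<open>T powr (r - q)\<close>.\<close>

lemma incr_order_mono:
  assumes "incr_order T r f" "q \<le> r"
  shows "incr_order T q f"
proof -
  obtain C where C: "C \<ge> 0" "\<And>s t. 0 \<le> s \<Longrightarrow> s < t \<Longrightarrow> t \<le> T \<Longrightarrow> norm (f s t) \<le> C * (t - s) powr r"
    using incr_orderE[OF assms(1)] by blast
  show ?thesis
  proof (rule incr_orderI)
    fix s t assume st: "0 \<le> s" "s < t" "t \<le> T"
    have "(t - s) powr r = (t - s) powr (r - q) * (t - s) powr q"
      by (simp flip: powr_add)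
    also have "\<dots> \<le> T powr (r - q) * (t - s) powr q"
      using st assms by (intro mult_right_mono powr_mono2) auto
    finally have "C * (t - s) powr r \<le> C * (T powr (r - q) * (t - s) powr q)"
      using C(1) by (rule mult_left_mono)
    with C(2)[OF st] show "norm (f s t) \<le> (C * T powr (r - q)) * (t - s) powr q"
      by (simp add: mult.assoc)
  qed
qed

lemma incr_order_const: "incr_order T 0 (\<lambda>s t. c)"
  by (rule incr_orderI[of _ _ "norm c"]) auto

lemma incr_order_scaleR: "incr_order T r f \<Longrightarrow> incr_order T r (\<lambda>s t. c *\<^sub>R f s t)"
  using incr_order_bilinear[OF bounded_bilinear_scaleR incr_order_const, of T r f c] by simp

lemma incr_order_time: "incr_order T 1 (\<lambda>s t. t - s)"
  by (rule incr_orderI[of _ _ 1]) auto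

text \<open>Comparison with the value at time 0. For \<open>s < t\<close> order 0 means boundedness,
  so coefficients enter a bilinear estimate without changing the exponent, whether they are taken at
  the left or at the right endpoint.\<close>

lemma incr_order_bounded:
  assumes "incr_order T r (\<lambda>s t. f t - f s)" "0 \<le> r"
  shows "incr_order T 0 (\<lambda>s t. f s)" "incr_order T 0 (\<lambda>s t. f t)"
proof -
  obtain C where C: "C \<ge> 0" "\<And>s t. 0 \<le> s \<Longrightarrow> s < t \<Longrightarrow> t \<le> T \<Longrightarrow> norm (f t - f s) \<le> C * (t - s) powr r"
    using incr_orderE[OF assms(1)] by blast
  have b: "norm (f u) \<le> norm (f 0) + C * T powr r" if u: "0 \<le> u" "u \<le> T" for u
  proof (cases "u = 0")
    case False
    have "norm (f u) \<le> norm (f 0) + norm (f u - f 0)" by norm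
    also have "norm (f u - f 0) \<le> C * u powr r" using C(2)[of 0 u] u False by simp
    also have "\<dots> \<le> C * T powr r" using u C assms by (intro mult_left_mono powr_mono2) auto
    finally show ?thesis by simp
  qed (use C in auto)
  show "incr_order T 0 (\<lambda>s t. f s)" "incr_order T 0 (\<lambda>s t. f t)"
    by (rule incr_orderI[of _ _ "norm (f 0) + C * T powr r"], use b in auto)+
qed

text \<open>Leibniz splitting: vary \<open>f\<close> with \<open>g\<close> at time \<open>t\<close>,
  then vary \<open>g\<close> with \<open>f\<close> at time \<open>s\<close>. The factor that stays
  fixed is bounded.\<close>

lemma incr_order_product_increment:
  assumes p: "bounded_bilinear p" and r: "0 \<le> r"
    and f: "incr_order T r (\<lambda>s t. f t - f s)" and g: "incr_order T r (\<lambda>s t. g t - g s)"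
  shows "incr_order T r (\<lambda>s t. p (f t) (g t) - p (f s) (g s))"
proof -
  interpret bounded_bilinear p by fact
  have "incr_order T r (\<lambda>s t. p (f t - f s) (g t) + p (f s) (g t - g s))"
    using incr_order_bilinear[OF p f incr_order_bounded(2)[OF g r]]
      incr_order_bilinear[OF p incr_order_bounded(1)[OF f r] g]
    by (intro incr_order_add) simp_all
  then show ?thesis by (simp add: diff_left diff_right)
qed

lemma incr_order_increment_add:
  assumes "incr_order T r (\<lambda>s t. f t - f s)" "incr_order T r (\<lambda>s t. g t - g s)"
  shows "incr_order T r (\<lambda>s t. (f t + g t) - (f s + g s))"
  using incr_order_add[OF assms] by (simp add: algebra_simps)

lemma incr_order_increment_const: "incr_order T r (\<lambda>s t. c - c)"
  by (rule incr_orderI[of _ _ 0]) auto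

text \<open>Provides compactness of the range of \<open>Y\<close>, the set on which the local bounds
  of a controlled field are invoked.\<close>

lemma continuous_on_incr_order:
  assumes "incr_order T r (\<lambda>s t. f t - f s)" "0 < r"
  shows "continuous_on {0..T} f"
proof -
  obtain C where C: "C \<ge> 0" "\<And>s t. 0 \<le> s \<Longrightarrow> s < t \<Longrightarrow> t \<le> T \<Longrightarrow> norm (f t - f s) \<le> C * (t - s) powr r"
    using incr_orderE[OF assms(1)] by blast
  \<comment> \<open>The order speaks of \<open>s < t\<close> only; symmetry of the distance gives
    the two-sided bound needed for the limit.\<close>
  have le: "dist (f t) (f s) \<le> C * \<bar>t - s\<bar> powr r" if "s \<in> {0..T}" "t \<in> {0..T}" for s t
    using that C(2)[of s t] C(2)[of t s]
    by (cases s t rule: linorder_cases) (auto simp: dist_norm norm_minus_commute)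
  show ?thesis
    unfolding continuous_on_def
  proof
    fix s assume s: "s \<in> {0..T}"
    have "((\<lambda>t. C * \<bar>t - s\<bar> powr r) \<longlongrightarrow> C * \<bar>s - s\<bar> powr r) (at s within {0..T})"
      using assms(2) by (intro tendsto_intros tendsto_powr') (auto intro!: always_eventually)
    then have "((\<lambda>t. C * \<bar>t - s\<bar> powr r) \<longlongrightarrow> 0) (at s within {0..T})" by simp
    then have "((\<lambda>t. dist (f t) (f s)) \<longlongrightarrow> 0) (at s within {0..T})"
      by (rule tendsto_0_le[where K = 1])
        (use le s C(1) in \<open>auto simp: eventually_at_filter abs_mult intro!: always_eventually\<close>)
    then show "(f \<longlongrightarrow> f s) (at s within {0..T})"
      by (rule tendsto_dist_iff[THEN iffD2])
  qed
qed

lemma incr_order_hoelder: "hoelder_on r T f \<Longrightarrow> incr_order T r (\<lambda>s t. f t - f s)"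
proof -
  assume "hoelder_on r T f"
  then obtain C where C: "\<And>s t. s \<in> {0..T} \<Longrightarrow> t \<in> {0..T} \<Longrightarrow> norm (f t - f s) \<le> C * \<bar>t - s\<bar> powr r"
    unfolding hoelder_on_def by blast
  have "norm (f t - f s) \<le> C * (t - s) powr r" if "0 \<le> s" "s < t" "t \<le> T" for s t
    using C[of s t] that by simp
  then show ?thesis by (rule incr_orderI)
qed

text \<open>Substitute \<open>x0 = Y s\<close> and \<open>x1 = Y t\<close>. Since \<open>Y\<close>
  has increments of order \<alpha>, the maximum in \<open>eq_to_order\<close> is at most
  \<open>(1 + D) * (t - s) powr \<alpha>\<close>, and its \<open>k\<close>-th power has order
  \<open>k * \<alpha>\<close>.\<close>

lemma incr_order_eq_to_order:
  assumes eq: "eq_to_order \<alpha> T (Y ` {0..T}) k A B" and Y: "incr_order T \<alpha> (\<lambda>s t. Y t - Y s)"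
  shows "incr_order T (real k * \<alpha>) (\<lambda>s t. A s t (Y s) (Y t) - B s t (Y s) (Y t))"
proof -
  obtain C where C: "\<And>t0 t1 x0 x1. 0 \<le> t0 \<Longrightarrow> t0 \<le> t1 \<Longrightarrow> t1 \<le> T \<Longrightarrow> x0 \<in> Y ` {0..T} \<Longrightarrow> x1 \<in> Y ` {0..T} \<Longrightarrow>
     norm (A t0 t1 x0 x1 - B t0 t1 x0 x1) \<le> C * (max (\<bar>t1 - t0\<bar> powr \<alpha>) (norm (x1 - x0))) ^ k"
    using eq unfolding eq_to_order_def by blast
  obtain D where D: "D \<ge> 0" "\<And>s t. 0 \<le> s \<Longrightarrow> s < t \<Longrightarrow> t \<le> T \<Longrightarrow> norm (Y t - Y s) \<le> D * (t - s) powr \<alpha>"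
    using incr_orderE[OF Y] by blast
  show ?thesis
  proof (rule incr_orderI)
    fix s t assume st: "0 \<le> s" "s < t" "t \<le> T"
    let ?m = "max (\<bar>t - s\<bar> powr \<alpha>) (norm (Y t - Y s))"
    have "?m \<le> (1 + D) * (t - s) powr \<alpha>"
      using D(2)[OF st] D(1) st by (simp add: distrib_right add_increasing)
    then have "?m ^ k \<le> ((1 + D) * (t - s) powr \<alpha>) ^ k"
      by (intro power_mono) (auto simp: le_max_iff_disj)
    also have "\<dots> = (1 + D) ^ k * (t - s) powr (real k * \<alpha>)"
      using st by (simp add: power_mult_distrib powr_power mult.commute)
    \<comment> \<open>The sign of \<open>C\<close> is not known, so its absolute value is used to
      multiply the inequality.\<close>
    finally have "\<bar>C\<bar> * ?m ^ k \<le> \<bar>C\<bar> * ((1 + D) ^ k * (t - s) powr (real k * \<alpha>))"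
      by (rule mult_left_mono) simp
    moreover have "norm (A s t (Y s) (Y t) - B s t (Y s) (Y t)) \<le> C * ?m ^ k"
      using st by (intro C) auto
    moreover have "C * ?m ^ k \<le> \<bar>C\<bar> * ?m ^ k"
      by (intro mult_right_mono zero_le_power) (auto simp: le_max_iff_disj)
    ultimately show "norm (A s t (Y s) (Y t) - B s t (Y s) (Y t))
        \<le> (\<bar>C\<bar> * (1 + D) ^ k) * (t - s) powr (real k * \<alpha>)"
      by (simp add: mult.assoc)
  qed
qed


section \<open>Maps on tensor products\<close>

lemma bounded_bilinear_partial_app:
  "bounded_bilinear (partial_app :: (('a::real_normed_vector, 'b::real_normed_vector) tensor \<Rightarrow>\<^sub>L 'c::real_normed_vector) \<Rightarrow> _)"
proof -
  interpret t: bounded_bilinear "(\<otimes>) :: 'a \<Rightarrow> 'b \<Rightarrow> _" by (rule bounded_bilinear_tens)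
  obtain K where K: "K \<ge> 0" "\<And>v w. norm ((v :: 'a) \<otimes> (w :: 'b)) \<le> norm v * norm w * K"
    using t.nonneg_bounded by blast
  show ?thesis
  proof
    have "norm (partial_app A e) \<le> norm A * norm e * K"
      for A :: "('a, 'b) tensor \<Rightarrow>\<^sub>L 'c" and e
    proof (rule norm_blinfun_bound)
      show "norm (blinfun_apply (partial_app A e) w) \<le> norm A * norm e * K * norm w" for w
        using order_trans[OF norm_blinfun mult_left_mono[OF K(2) norm_ge_zero], of A e w]
        by (simp add: mult_ac)
    qed (use K in simp)
    then show "\<exists>K. \<forall>A e. norm (partial_app (A :: ('a, 'b) tensor \<Rightarrow>\<^sub>L 'c) e) \<le> norm A * norm e * K"
      by blast
  qed (auto intro!: blinfun_eqI simp: blinfun.bilinear_simps t.add_left t.scaleR_left)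
qed

text \<open>In fixed coordinates, \<open>tensor_expansion\<close> writes the lift at \<tau> through
  the values of \<beta> on coordinate vectors. Hence \<open>C\<close> depends on the spaces alone;
  this uniformity in \<beta> makes \<open>tensor_map\<close> jointly bounded in its two
  arguments.\<close>

lemma norm_tensor_lift_bound:
  "\<exists>C. \<forall>(\<beta> :: 'a::finite_dim_banach \<Rightarrow> 'b::finite_dim_banach \<Rightarrow> 'c::real_normed_vector). \<forall>K\<ge>0.
     bounded_bilinear \<beta> \<longrightarrow> (\<forall>v w. norm (\<beta> v w) \<le> K * norm v * norm w) \<longrightarrow> norm (tensor_lift \<beta>) \<le> C * K"
proof -
  obtain B :: "'a set" and \<phi> where B: "\<And>v. v = (\<Sum>b\<in>B. blinfun_apply (\<phi> b) v *\<^sub>R b)"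
    using coordinate_functionals by blast
  obtain D :: "'b set" and \<psi> where D: "\<And>w. w = (\<Sum>c\<in>D. blinfun_apply (\<psi> c) w *\<^sub>R c)"
    using coordinate_functionals by blast
  define C where "C = (\<Sum>b\<in>B. \<Sum>c\<in>D. norm (form_prod (\<phi> b) (\<psi> c)) * (norm b * norm c))"
  show ?thesis
  proof (intro exI[of _ C] conjI allI impI)
    fix \<beta> :: "'a \<Rightarrow> 'b \<Rightarrow> 'c" and K :: real
    assume K0: "0 \<le> K" and \<beta>: "bounded_bilinear \<beta>" and K: "\<forall>v w. norm (\<beta> v w) \<le> K * norm v * norm w"
    show "norm (tensor_lift \<beta>) \<le> C * K"
    proof (rule norm_blinfun_bound)
      show "0 \<le> C * K" using K0 by (simp add: C_def sum_nonneg)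
      fix \<tau>
      have "norm (blinfun_apply (tensor_lift \<beta>) \<tau>) =
          norm (\<Sum>b\<in>B. \<Sum>c\<in>D. blinfun_apply \<tau> (form_prod (\<phi> b) (\<psi> c)) *\<^sub>R \<beta> b c)"
        by (subst tensor_expansion[OF B D, of \<tau>])
          (simp add: blinfun.bilinear_simps tensor_lift_tens[OF \<beta>])
      also have "\<dots> \<le> (\<Sum>b\<in>B. \<Sum>c\<in>D. norm (form_prod (\<phi> b) (\<psi> c)) * (norm b * norm c) * K * norm \<tau>)"
      proof (intro sum_norm_le)
        fix b c
        have "norm (blinfun_apply \<tau> (form_prod (\<phi> b) (\<psi> c)) *\<^sub>R \<beta> b c)
            \<le> (norm \<tau> * norm (form_prod (\<phi> b) (\<psi> c))) * (K * norm b * norm c)"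
          unfolding norm_scaleR using K norm_blinfun[of \<tau> "form_prod (\<phi> b) (\<psi> c)"]
          by (intro mult_mono) auto
        then show "norm (blinfun_apply \<tau> (form_prod (\<phi> b) (\<psi> c)) *\<^sub>R \<beta> b c)
            \<le> norm (form_prod (\<phi> b) (\<psi> c)) * (norm b * norm c) * K * norm \<tau>"
          by (simp add: mult_ac)
      qed
      finally show "norm (blinfun_apply (tensor_lift \<beta>) \<tau>) \<le> C * K * norm \<tau>"
        by (simp add: C_def sum_distrib_right)
    qed
  qed
qed

text \<open>This is the tensor product of two linear maps. Substituting \<open>Y'\<close> into a map
  on tensors becomes composition with it, so that the Leibniz estimate applies.\<close>

definition tensor_map :: "('a::finite_dim_banach \<Rightarrow>\<^sub>L 'c::real_normed_vector) \<Rightarrow>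
    ('b::finite_dim_banach \<Rightarrow>\<^sub>L 'd::real_normed_vector) \<Rightarrow> ('a, 'b) tensor \<Rightarrow>\<^sub>L ('c, 'd) tensor" where
  "tensor_map P Q = tensor_lift (\<lambda>v w. blinfun_apply P v \<otimes> blinfun_apply Q w)"

lemma bounded_bilinear_tens_blinfun:
  "bounded_bilinear (\<lambda>v w. blinfun_apply P v \<otimes> blinfun_apply Q w)"
  by (rule bounded_bilinear.comp[OF bounded_bilinear_tens]) (rule blinfun.bounded_linear_right)+

lemma tensor_map_tens [simp]:
  "blinfun_apply (tensor_map P Q) (v \<otimes> w) = blinfun_apply P v \<otimes> blinfun_apply Q w"
  unfolding tensor_map_def by (rule tensor_lift_tens[OF bounded_bilinear_tens_blinfun])

lemma bounded_bilinear_tensor_map: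
  "bounded_bilinear (tensor_map :: ('a::finite_dim_banach \<Rightarrow>\<^sub>L 'c::real_normed_vector) \<Rightarrow>
    ('b::finite_dim_banach \<Rightarrow>\<^sub>L 'd::real_normed_vector) \<Rightarrow> _)"
proof -
  interpret t: bounded_bilinear "(\<otimes>) :: 'c \<Rightarrow> 'd \<Rightarrow> _" by (rule bounded_bilinear_tens)
  obtain K where K: "K \<ge> 0" "\<And>v w. norm ((v :: 'c) \<otimes> (w :: 'd)) \<le> norm v * norm w * K"
    using t.nonneg_bounded by blast
  obtain C where C: "\<And>(\<beta> :: 'a \<Rightarrow> 'b \<Rightarrow> ('c, 'd) tensor) K. 0 \<le> K \<Longrightarrow> bounded_bilinear \<beta> \<Longrightarrow>
      (\<And>v w. norm (\<beta> v w) \<le> K * norm v * norm w) \<Longrightarrow> norm (tensor_lift \<beta>) \<le> C * K"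
    using norm_tensor_lift_bound by metis
  show ?thesis
  proof
    have "norm (tensor_map P Q) \<le> C * (norm P * norm Q * K)" for P :: "'a \<Rightarrow>\<^sub>L 'c" and Q :: "'b \<Rightarrow>\<^sub>L 'd"
      unfolding tensor_map_def
    proof (rule C)
      fix v w
      have "norm (blinfun_apply P v \<otimes> blinfun_apply Q w) \<le> (norm P * norm v) * (norm Q * norm w) * K"
        using K(1) by (intro order_trans[OF K(2)] mult_right_mono mult_mono norm_blinfun) auto
      then show "norm (blinfun_apply P v \<otimes> blinfun_apply Q w) \<le> norm P * norm Q * K * norm v * norm w"
        by (simp add: mult_ac)
    qed (use K in \<open>auto intro: bounded_bilinear_tens_blinfun\<close>)
    then show "\<exists>K. \<forall>P Q. norm (tensor_map (P :: 'a \<Rightarrow>\<^sub>L 'c) (Q :: 'b \<Rightarrow>\<^sub>L 'd)) \<le> norm P * norm Q * K"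
      by (intro exI[of _ "C * K"]) (simp add: mult_ac)
  qed (auto intro!: tensor_maps_eqI simp: blinfun.bilinear_simps t.add_left t.add_right t.scaleR_left t.scaleR_right)
qed

text \<open>Both sides agree on elementary tensors. It identifies the lifts that define
  \<open>dF'Y'\<close> and \<open>ddFY'Y'\<close> with compositions.\<close>

lemma blinfun_compose_tensor_map:
  "A o\<^sub>L tensor_map P Q = tensor_lift (\<lambda>v w. blinfun_apply A (blinfun_apply P v \<otimes> blinfun_apply Q w))"
  by (rule tensor_maps_eqI)
    (simp add: tensor_lift_tens bounded_bilinear_blinfun_tens blinfun.bounded_linear_right)

definition tensor_swap :: "('a::finite_dim_banach, 'b::finite_dim_banach) tensor \<Rightarrow>\<^sub>L ('b, 'a) tensor" where
  "tensor_swap = tensor_lift (\<lambda>v w. w \<otimes> v)"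

lemma tensor_swap_tens [simp]: "blinfun_apply tensor_swap (v \<otimes> w) = w \<otimes> v"
  unfolding tensor_swap_def
  by (rule tensor_lift_tens[OF bounded_bilinear.flip[OF bounded_bilinear_tens]])

text \<open>Transposition becomes composition with one fixed bounded map, so it preserves orders of
  increments, and a swap can move between a map and its argument.\<close>

lemma tensor_transpose_conv_swap: "tensor_transpose A = A o\<^sub>L tensor_swap"
proof (rule tensor_maps_eqI)
  have "bounded_bilinear (\<lambda>e' e. blinfun_apply A (e \<otimes> e'))"
    by (rule bounded_bilinear.flip[OF bounded_bilinear_blinfun_tens[OF bounded_linear_ident bounded_linear_ident]])
  then show "blinfun_apply (tensor_transpose A) (v \<otimes> w) = blinfun_apply (A o\<^sub>L tensor_swap) (v \<otimes> w)" for v w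
    unfolding tensor_transpose_def by (simp add: tensor_lift_tens)
qed

text \<open>Inserting the same \<open>P\<close> in both slots keeps the symmetry of
  \<open>A\<close>, so the swap is absorbed.\<close>

lemma symmetric_map_tensor_map:
  assumes "symmetric_map A"
  shows "blinfun_apply (A o\<^sub>L tensor_map P P) (blinfun_apply tensor_swap \<tau>) = blinfun_apply (A o\<^sub>L tensor_map P P) \<tau>"
proof -
  have "blinfun_apply A (w \<otimes> v) = blinfun_apply A (v \<otimes> w)" for v w
    using assms unfolding symmetric_map_def tensor_transpose_conv_swap
    by (metis blinfun_apply_blinfun_compose tensor_swap_tens)
  then have "(A o\<^sub>L tensor_map P P) o\<^sub>L tensor_swap = A o\<^sub>L tensor_map P P"
    by (intro tensor_maps_eqI) simp
  then show ?thesis by (metis blinfun_apply_blinfun_compose)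
qed


section \<open>The bracket\<close>

lemma bracket_conv_swap:
  "bracket X XX s t = (X t - X s) \<otimes> (X t - X s) - (XX s t + blinfun_apply tensor_swap (XX s t))"
  by (simp add: bracket_def Sym_def tensor_swap_def)

text \<open>Chen's relation between 0, \<open>s\<close> and \<open>t\<close>: the cross terms in the
  square of \<open>X t - X 0\<close> cancel against the symmetrisation of
  \<open>(X s - X 0) \<otimes> (X t - X s)\<close>.\<close>

lemma bracket_eq_increment:
  assumes "(X, XX) \<in> rough_paths \<alpha> T" "0 \<le> s" "s < t" "t \<le> T"
  shows "bracket X XX s t = bracket_path X XX t - bracket_path X XX s"
proof -
  interpret t: bounded_bilinear "(\<otimes>) :: 'a \<Rightarrow> 'a \<Rightarrow> _" by (rule bounded_bilinear_tens)
  show ?thesis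
  \<comment> \<open>Chen's relation is stated for strictly ordered times, so it applies with middle
    time \<open>s\<close> only if \<open>s > 0\<close>. At \<open>s = 0\<close> the convention
    \<open>XX 0 0 = 0\<close> makes the bracket path start at zero.\<close>
  proof (cases "s = 0")
    case True
    have "XX 0 0 = 0" using assms by (auto simp: rough_paths_def)
    then show ?thesis
      using True by (simp add: bracket_path_def bracket_conv_swap t.zero_left blinfun.zero_right)
  next
    case False
    then have "XX 0 t - XX 0 s - XX s t = (X s - X 0) \<otimes> (X t - X s)"
      using assms by (auto simp: rough_paths_def)
    then have chen: "XX 0 t = XX 0 s + XX s t + (X s - X 0) \<otimes> (X t - X s)"
      by (simp add: algebra_simps)
    show ?thesis
      unfolding bracket_path_def bracket_conv_swap chen
      by (simp add: blinfun.bilinear_simps t.diff_left t.diff_right algebra_simps)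
  qed
qed

text \<open>On \<open>{s..t}\<close> the derivative differs from its value at \<open>s\<close> by at
  most \<open>C * (t - s) powr \<alpha>\<close>; the mean value inequality contributes the further
  factor \<open>t - s\<close>.\<close>

lemma incr_order_bracket_linearization:
  assumes X: "(X, XX) \<in> rough_paths_C1_bracket \<alpha> T" and "0 \<le> \<alpha>"
  shows "incr_order T (1 + \<alpha>) (\<lambda>s t. bracket X XX s t - (t - s) *\<^sub>R bracket_deriv T X XX s)"
proof -
  let ?f = "bracket_path X XX" and ?f' = "bracket_deriv T X XX"
  have rp: "(X, XX) \<in> rough_paths \<alpha> T"
    and d: "\<And>u. u \<in> {0..T} \<Longrightarrow> (?f has_vector_derivative ?f' u) (at u within {0..T})"
    and h: "hoelder_on \<alpha> T ?f'"
    using X by (auto simp: rough_paths_C1_bracket_def bracket_deriv_def vector_derivative_works[symmetric])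
  obtain C where C: "C \<ge> 0" "\<And>s t. 0 \<le> s \<Longrightarrow> s < t \<Longrightarrow> t \<le> T \<Longrightarrow> norm (?f' t - ?f' s) \<le> C * (t - s) powr \<alpha>"
    using incr_orderE[OF incr_order_hoelder[OF h]] by blast
  show ?thesis
  proof (rule incr_orderI)
    fix s t assume st: "0 \<le> s" "s < t" "t \<le> T"
    have "norm (?f t - ?f s - (t - s) *\<^sub>R ?f' s) \<le> norm (t - s) * (C * (t - s) powr \<alpha>)"
    proof (rule vector_differentiable_bound_linearization[where S = "{s..t}"])
      show "(?f has_vector_derivative ?f' u) (at u within {s..t})" if "u \<in> {s..t}" for u
        by (rule has_vector_derivative_within_subset[OF d]) (use that st in auto)
      show "norm (?f' u - ?f' s) \<le> C * (t - s) powr \<alpha>" if "u \<in> {s..t}" for u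
      proof (cases "u = s")
        case False
        then have "norm (?f' u - ?f' s) \<le> C * (u - s) powr \<alpha>" using C(2)[of s u] that st by simp
        also have "\<dots> \<le> C * (t - s) powr \<alpha>"
          using that C(1) \<open>0 \<le> \<alpha>\<close> by (intro mult_left_mono powr_mono2) auto
        finally show ?thesis .
      qed (use C in simp)
    qed (use st in \<open>auto simp: closed_segment_eq_real_ivl\<close>)
    then show "norm (bracket X XX s t - (t - s) *\<^sub>R ?f' s) \<le> C * (t - s) powr (1 + \<alpha>)"
      using st by (simp add: bracket_eq_increment[OF rp st] powr_add mult_ac)
  qed
qed


section \<open>Composition\<close>

text \<open>Separates the common constant into four independent orders. Conversely the sum of four
  nonnegative constants serves for all the bounds.\<close>

lemma strongly_controlled_iff_incr_order:
  "(Y, Y', Y'', Yd) \<in> strongly_controlled \<alpha> T X XX \<longleftrightarrow>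
     incr_order T (3 * \<alpha>) (\<lambda>s t. Y t - Y s - blinfun_apply (Y' s) (X t - X s) - blinfun_apply (Y'' s) (XX s t)
           - (t - s) *\<^sub>R Yd s) \<and>
     incr_order T (2 * \<alpha>) (\<lambda>s t. Y' t - Y' s - partial_app (Y'' s) (X t - X s)) \<and>
     incr_order T \<alpha> (\<lambda>s t. Y'' t - Y'' s) \<and> incr_order T \<alpha> (\<lambda>s t. Yd t - Yd s)"
    (is "_ \<longleftrightarrow> incr_order _ _ ?R3 \<and> incr_order _ _ ?R2 \<and> incr_order _ _ ?D1 \<and> incr_order _ _ ?D2")
proof
  assume "(Y, Y', Y'', Yd) \<in> strongly_controlled \<alpha> T X XX"
  then obtain C where C: "\<And>s t. 0 \<le> s \<Longrightarrow> s < t \<Longrightarrow> t \<le> T \<Longrightarrow> norm (?R3 s t) \<le> C * (t - s) powr (3 * \<alpha>) \<and>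
      norm (?R2 s t) \<le> C * (t - s) powr (2 * \<alpha>) \<and> norm (?D1 s t) + norm (?D2 s t) \<le> C * (t - s) powr \<alpha>"
    unfolding strongly_controlled_def by blast
  have "norm (?D1 s t) \<le> C * (t - s) powr \<alpha> \<and> norm (?D2 s t) \<le> C * (t - s) powr \<alpha>"
    if "0 \<le> s" "s < t" "t \<le> T" for s t
    using C[OF that] norm_ge_zero[of "?D1 s t"] norm_ge_zero[of "?D2 s t"] by linarith
  then show "incr_order T (3 * \<alpha>) ?R3 \<and> incr_order T (2 * \<alpha>) ?R2 \<and> incr_order T \<alpha> ?D1 \<and> incr_order T \<alpha> ?D2"
    using C by (intro conjI incr_orderI[of _ _ C]) blast+
next
  assume *: "incr_order T (3 * \<alpha>) ?R3 \<and> incr_order T (2 * \<alpha>) ?R2 \<and> incr_order T \<alpha> ?D1 \<and> incr_order T \<alpha> ?D2"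
  obtain C1 where C1: "C1 \<ge> 0" "\<And>s t. 0 \<le> s \<Longrightarrow> s < t \<Longrightarrow> t \<le> T \<Longrightarrow> norm (?R3 s t) \<le> C1 * (t - s) powr (3 * \<alpha>)"
    using incr_orderE[OF *[THEN conjunct1]] by blast
  obtain C2 where C2: "C2 \<ge> 0" "\<And>s t. 0 \<le> s \<Longrightarrow> s < t \<Longrightarrow> t \<le> T \<Longrightarrow> norm (?R2 s t) \<le> C2 * (t - s) powr (2 * \<alpha>)"
    using incr_orderE[OF *[THEN conjunct2, THEN conjunct1]] by blast
  obtain C3 where C3: "C3 \<ge> 0" "\<And>s t. 0 \<le> s \<Longrightarrow> s < t \<Longrightarrow> t \<le> T \<Longrightarrow> norm (?D1 s t) \<le> C3 * (t - s) powr \<alpha>"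
    using incr_orderE[OF *[THEN conjunct2, THEN conjunct2, THEN conjunct1]] by blast
  obtain C4 where C4: "C4 \<ge> 0" "\<And>s t. 0 \<le> s \<Longrightarrow> s < t \<Longrightarrow> t \<le> T \<Longrightarrow> norm (?D2 s t) \<le> C4 * (t - s) powr \<alpha>"
    using incr_orderE[OF *[THEN conjunct2, THEN conjunct2, THEN conjunct2]] by blast
  define C where "C = C1 + C2 + C3 + C4"
  have le: "c * (t - s) powr r \<le> C * (t - s) powr r" if "c \<le> C" for c r s t
    using that by (intro mult_right_mono) auto
  have "norm (?R3 s t) \<le> C * (t - s) powr (3 * \<alpha>) \<and> norm (?R2 s t) \<le> C * (t - s) powr (2 * \<alpha>) \<and>
      norm (?D1 s t) + norm (?D2 s t) \<le> C * (t - s) powr \<alpha>" if st: "0 \<le> s" "s < t" "t \<le> T" for s t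
  proof (intro conjI)
    show "norm (?R3 s t) \<le> C * (t - s) powr (3 * \<alpha>)"
      by (rule order_trans[OF C1(2)[OF st] le]) (use C1(1) C2(1) C3(1) C4(1) in \<open>simp add: C_def\<close>)
    show "norm (?R2 s t) \<le> C * (t - s) powr (2 * \<alpha>)"
      by (rule order_trans[OF C2(2)[OF st] le]) (use C1(1) C2(1) C3(1) C4(1) in \<open>simp add: C_def\<close>)
    have "norm (?D1 s t) + norm (?D2 s t) \<le> (C3 + C4) * (t - s) powr \<alpha>"
      unfolding distrib_right by (rule add_mono[OF C3(2)[OF st] C4(2)[OF st]])
    also have "\<dots> \<le> C * (t - s) powr \<alpha>"
      by (rule le) (use C1(1) C2(1) in \<open>simp add: C_def\<close>)
    finally show "norm (?D1 s t) + norm (?D2 s t) \<le> C * (t - s) powr \<alpha>" .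
  qed
  then show "(Y, Y', Y'', Yd) \<in> strongly_controlled \<alpha> T X XX"
    unfolding strongly_controlled_def by blast
qed

text \<open>The range \<open>\<alpha> \<le> 1/2\<close> gives both
  \<open>2 * \<alpha> \<le> 1\<close> and \<open>3 * \<alpha> \<le> 1 + \<alpha>\<close>, used for
  the drift of \<open>Y\<close> and for the bracket; \<open>composition_fails_above_half\<close>
  shows failure beyond it. The composed functions are prescribed on \<open>{0..T}\<close>, the times
  that \<open>strongly_controlled\<close> sees.\<close>

theorem corollary3p13:
  fixes \<alpha> T :: real
    and X :: "real \<Rightarrow> 'v::finite_dim_banach" and XX :: "real \<Rightarrow> real \<Rightarrow> ('v, 'v) tensor"
    and Y Yd :: "real \<Rightarrow> 'w::finite_dim_banach" and Y' :: "real \<Rightarrow> 'v \<Rightarrow>\<^sub>L 'w"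
    and Y'' :: "real \<Rightarrow> ('v, 'v) tensor \<Rightarrow>\<^sub>L 'w"
    and F Fd :: "real \<Rightarrow> 'w \<Rightarrow> 'u::finite_dim_banach"
    and F' :: "real \<Rightarrow> 'w \<Rightarrow> 'v \<Rightarrow>\<^sub>L 'u" and dF :: "real \<Rightarrow> 'w \<Rightarrow> 'w \<Rightarrow>\<^sub>L 'u"
    and F'' :: "real \<Rightarrow> 'w \<Rightarrow> ('v, 'v) tensor \<Rightarrow>\<^sub>L 'u"
    and dF' :: "real \<Rightarrow> 'w \<Rightarrow> ('w, 'v) tensor \<Rightarrow>\<^sub>L 'u"
    and ddF :: "real \<Rightarrow> 'w \<Rightarrow> ('w, 'w) tensor \<Rightarrow>\<^sub>L 'u"
    and dF'Y' ddFY'Y' :: "real \<Rightarrow> ('v, 'v) tensor \<Rightarrow>\<^sub>L 'u"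
    and Z Zd :: "real \<Rightarrow> 'u" and Z' :: "real \<Rightarrow> 'v \<Rightarrow>\<^sub>L 'u" and Z'' :: "real \<Rightarrow> ('v, 'v) tensor \<Rightarrow>\<^sub>L 'u"
  assumes "0 < \<alpha>" "\<alpha> \<le> 1/2" "0 < T"
    and "(X, XX) \<in> rough_paths_C1_bracket \<alpha> T"
    and "(Y, Y', Y'', Yd) \<in> strongly_controlled \<alpha> T X XX"
    and "(F, F', dF, F'', dF', ddF, Fd) \<in> controlled_fields \<alpha> T X XX"
    and "\<And>t. t \<in> {0..T} \<Longrightarrow>
      dF'Y' t = tensor_lift (\<lambda>v1 v2. blinfun_apply (dF' t (Y t)) (blinfun_apply (Y' t) v1 \<otimes> v2))"
    and "\<And>t. t \<in> {0..T} \<Longrightarrow>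
      ddFY'Y' t = tensor_lift (\<lambda>v1 v2. blinfun_apply (ddF t (Y t))
        (blinfun_apply (Y' t) v1 \<otimes> blinfun_apply (Y' t) v2))"
    and "\<And>t. t \<in> {0..T} \<Longrightarrow> Z t = F t (Y t)"
    and "\<And>t. t \<in> {0..T} \<Longrightarrow> Z' t = F' t (Y t) + (dF t (Y t) o\<^sub>L Y' t)"
    and "\<And>t. t \<in> {0..T} \<Longrightarrow>
      Z'' t = (dF t (Y t) o\<^sub>L Y'' t) + F'' t (Y t) + dF'Y' t + tensor_transpose (dF'Y' t) + ddFY'Y' t"
    and "\<And>t. t \<in> {0..T} \<Longrightarrow>
      Zd t = blinfun_apply (dF t (Y t)) (Yd t) + Fd t (Y t)
        + blinfun_apply (dF'Y' t + (1/2) *\<^sub>R ddFY'Y' t) (bracket_deriv T X XX t)"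
  shows "(Z, Z', Z'', Zd) \<in> strongly_controlled \<alpha> T X XX"
proof -
  note \<alpha> = assms(1,2) and Z_eqs = assms(7-12)

  \<comment> \<open>Coefficients of the field along the path\<close>
  define c where "c t = dF' t (Y t)" for t
  define e where "e t = ddF t (Y t)" for t
  define a where "a t = dF t (Y t)" for t
  \<comment> \<open>\<open>P\<close> and \<open>Q\<close> will be identified with
    \<open>dF'Y'\<close> and \<open>ddFY'Y'\<close>; as compositions their increments can be
    estimated by the product rule.\<close>
  define P where "P t = c t o\<^sub>L tensor_map (Y' t) id_blinfun" for t
  define Q where "Q t = e t o\<^sub>L tensor_map (Y' t) (Y' t)" for t
  let ?O = "incr_order T"
  let ?dX = "\<lambda>s t. X t - X s" and ?dY = "\<lambda>s t. Y t - Y s"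
  note fields = assms(6)[unfolded controlled_fields_def mem_Collect_eq prod.case]
  note tens = bounded_bilinear_tens
    and app = bounded_bilinear_blinfun_apply and comp = bounded_bilinear_blinfun_compose
    and pa = bounded_bilinear_partial_app
  interpret tn: bounded_bilinear "(\<otimes>) :: 'p::real_normed_vector \<Rightarrow> 'q::real_normed_vector \<Rightarrow> _"
    by (rule tens)

  \<comment> \<open>Orders of the rough path and of time\<close>
  have rp: "(X, XX) \<in> rough_paths \<alpha> T" and hb: "hoelder_on \<alpha> T (bracket_deriv T X XX)"
    using assms(4) by (auto simp: rough_paths_C1_bracket_def)
  then have X1: "?O \<alpha> ?dX"
    by (auto simp: rough_paths_def intro: incr_order_hoelder)
  have XX2: "?O (2 * \<alpha>) XX"
    using rp by (auto simp: rough_paths_def incr_order_def)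
  \<comment> \<open>Here \<open>2 * \<alpha> \<le> 1\<close> enters: the drift of \<open>Y\<close>
    is absorbed into remainders of order \<open>2 * \<alpha>\<close>.\<close>
  have time2: "?O (2 * \<alpha>) (\<lambda>s t. t - s)"
    using \<alpha> by (auto intro: incr_order_mono[OF incr_order_time])

  \<comment> \<open>Orders of the controlled path\<close>
  note Y_orders = assms(5)[unfolded strongly_controlled_iff_incr_order]
  have Y3: "?O (3 * \<alpha>) (\<lambda>s t. ?dY s t - blinfun_apply (Y' s) (?dX s t) - blinfun_apply (Y'' s) (XX s t)
           - (t - s) *\<^sub>R Yd s)"
    using Y_orders by blast
  have Y'2: "?O (2 * \<alpha>) (\<lambda>s t. Y' t - Y' s - partial_app (Y'' s) (?dX s t))"
    and Y''1: "?O \<alpha> (\<lambda>s t. Y'' t - Y'' s)"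
    and Yd1: "?O \<alpha> (\<lambda>s t. Yd t - Yd s)"
    using Y_orders by blast+
  note Y''0 = incr_order_bounded(1)[OF Y''1 less_imp_le[OF \<alpha>(1)]]
    and Yd0 = incr_order_bounded(1)[OF Yd1 less_imp_le[OF \<alpha>(1)]]
  have pYX1: "?O \<alpha> (\<lambda>s t. partial_app (Y'' s) (?dX s t))"
    using incr_order_bilinear[OF pa Y''0 X1] by simp
  have Y'1: "?O \<alpha> (\<lambda>s t. Y' t - Y' s)"
    using incr_order_add[OF incr_order_mono[OF Y'2] pYX1] \<alpha> by simp
  note Y'0 = incr_order_bounded(1)[OF Y'1 less_imp_le[OF \<alpha>(1)]]
  have Y'X1: "?O \<alpha> (\<lambda>s t. blinfun_apply (Y' s) (?dX s t))"
    using incr_order_bilinear[OF app Y'0 X1] by simp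
  \<comment> \<open>The terms with \<open>Y''\<close> and \<open>Yd\<close> are themselves of order
    \<open>2 * \<alpha>\<close>; adding them back leaves the coarser first-order expansion of
    \<open>Y\<close>, which suffices in every quadratic term.\<close>
  have YR2: "?O (2 * \<alpha>) (\<lambda>s t. ?dY s t - blinfun_apply (Y' s) (?dX s t))"
  proof -
    have "?O (2 * \<alpha>) (\<lambda>s t. blinfun_apply (Y'' s) (XX s t))" "?O (2 * \<alpha>) (\<lambda>s t. (t - s) *\<^sub>R Yd s)"
      using incr_order_bilinear[OF app Y''0 XX2]
        incr_order_bilinear[OF bounded_bilinear_scaleR time2 Yd0] by simp_all
    from incr_order_add[OF incr_order_add[OF incr_order_mono[OF Y3] this(1)] this(2)]
    show ?thesis using \<alpha> by simp
  qed
  have Y1: "?O \<alpha> ?dY"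
    using incr_order_add[OF incr_order_mono[OF YR2] Y'X1] \<alpha> by simp

  \<comment> \<open>Expansions of the field along the path\<close>
  have K: "compact (Y ` {0..T})"
    using continuous_on_incr_order[OF Y1 \<alpha>(1)] by (intro compact_continuous_image) auto
  note along = incr_order_eq_to_order[OF _ Y1]
    and fK = fields[THEN conjunct2, rule_format, OF K]
  have F3: "?O (3 * \<alpha>) (\<lambda>s t. F t (Y t) - (F s (Y s) + blinfun_apply (F' s (Y s)) (?dX s t)
            + blinfun_apply (a s) (?dY s t) + blinfun_apply (F'' s (Y s)) (XX s t)
            + blinfun_apply (c s) (?dY s t \<otimes> ?dX s t)
            + (1/2) *\<^sub>R blinfun_apply (e s) (?dY s t \<otimes> ?dY s t)
            + (t - s) *\<^sub>R Fd s (Y s)))"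
    using along[OF fK[THEN conjunct1]] unfolding a_def c_def e_def by (simp only: of_nat_numeral of_nat_1 mult_1)
  have F'2: "?O (2 * \<alpha>) (\<lambda>s t. F' t (Y t) - (F' s (Y s) + partial_app (F'' s (Y s)) (?dX s t)
            + partial_app (c s) (?dY s t)))"
    using along[OF fK[THEN conjunct2, THEN conjunct1]] unfolding a_def c_def e_def by (simp only: of_nat_numeral of_nat_1 mult_1)
  have dF2: "?O (2 * \<alpha>) (\<lambda>s t. a t - (a s + partial_app (tensor_transpose (c s)) (?dX s t)
            + partial_app (e s) (?dY s t)))"
    using along[OF fK[THEN conjunct2, THEN conjunct2, THEN conjunct1]] unfolding a_def c_def e_def by (simp only: of_nat_numeral of_nat_1 mult_1)
  have F''1: "?O \<alpha> (\<lambda>s t. F'' t (Y t) - F'' s (Y s))"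
    using along[OF fK[THEN conjunct2, THEN conjunct2, THEN conjunct2, THEN conjunct1]] unfolding a_def c_def e_def by (simp only: of_nat_numeral of_nat_1 mult_1)
  have c1: "?O \<alpha> (\<lambda>s t. c t - c s)"
    using along[OF fK[THEN conjunct2, THEN conjunct2, THEN conjunct2, THEN conjunct2, THEN conjunct1]] unfolding a_def c_def e_def by (simp only: of_nat_numeral of_nat_1 mult_1)
  have e1: "?O \<alpha> (\<lambda>s t. e t - e s)"
    using along[OF fK[THEN conjunct2, THEN conjunct2, THEN conjunct2, THEN conjunct2, THEN conjunct2, THEN conjunct1]] unfolding a_def c_def e_def by (simp only: of_nat_numeral of_nat_1 mult_1)
  have Fd1: "?O \<alpha> (\<lambda>s t. Fd t (Y t) - Fd s (Y s))"
    using along[OF fK[THEN conjunct2, THEN conjunct2, THEN conjunct2, THEN conjunct2, THEN conjunct2, THEN conjunct2]] unfolding a_def c_def e_def by (simp only: of_nat_numeral of_nat_1 mult_1)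
  note c0 = incr_order_bounded(1)[OF c1 less_imp_le[OF \<alpha>(1)]]
    and e0 = incr_order_bounded(1)[OF e1 less_imp_le[OF \<alpha>(1)]]
  have ct1: "?O \<alpha> (\<lambda>s t. tensor_transpose (c t) - tensor_transpose (c s))"
    unfolding tensor_transpose_conv_swap
    by (rule incr_order_product_increment[OF comp less_imp_le[OF \<alpha>(1)] c1 incr_order_increment_const])
  \<comment> \<open>Both first-order terms of the expansion of \<open>a\<close> have order \<alpha>,
    so adding them back to its second-order remainder bounds the increment.\<close>
  have a1: "?O \<alpha> (\<lambda>s t. a t - a s)"
  proof -
    have "?O \<alpha> (\<lambda>s t. partial_app (tensor_transpose (c s)) (?dX s t))" "?O \<alpha> (\<lambda>s t. partial_app (e s) (?dY s t))"
      using incr_order_bilinear[OF pa incr_order_bounded(1)[OF ct1 less_imp_le[OF \<alpha>(1)]] X1]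
        incr_order_bilinear[OF pa e0 Y1] \<alpha> by simp_all
    from incr_order_add[OF incr_order_add[OF incr_order_mono[OF dF2] this(1)] this(2)]
    show ?thesis using \<alpha> by simp
  qed
  note a0 = incr_order_bounded[OF a1 less_imp_le[OF \<alpha>(1)]]
  note product_increment = incr_order_product_increment[OF _ less_imp_le[OF \<alpha>(1)]]
  \<comment> \<open>Nested products: the Leibniz estimate is applied inside
    \<open>tensor_map\<close> first, then to the outer composition.\<close>
  have P1: "?O \<alpha> (\<lambda>s t. P t - P s)" and Q1: "?O \<alpha> (\<lambda>s t. Q t - Q s)"
    unfolding P_def Q_def
    by (rule product_increment[OF comp c1 product_increment[OF bounded_bilinear_tensor_map Y'1 incr_order_increment_const]]
        product_increment[OF comp e1 product_increment[OF bounded_bilinear_tensor_map Y'1 Y'1]])+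
  have PQ1: "?O \<alpha> (\<lambda>s t. (P t + (1/2) *\<^sub>R Q t) - (P s + (1/2) *\<^sub>R Q s))"
    by (rule incr_order_increment_add[OF P1 product_increment[OF bounded_bilinear_scaleR incr_order_increment_const Q1]])

  \<comment> \<open>The composed functions in terms of \<open>P\<close> and \<open>Q\<close>\<close>
  have dF'Y': "dF'Y' t = P t" and ddFY'Y': "ddFY'Y' t = Q t" if "t \<in> {0..T}" for t
    using that by (simp_all add: Z_eqs P_def Q_def c_def e_def blinfun_compose_tensor_map)
  have Z: "Z t = F t (Y t)" "Z' t = F' t (Y t) + (a t o\<^sub>L Y' t)"
      "Z'' t = (a t o\<^sub>L Y'' t) + F'' t (Y t) + P t + (P t o\<^sub>L tensor_swap) + Q t"
      "Zd t = blinfun_apply (a t) (Yd t) + Fd t (Y t)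
        + blinfun_apply (P t + (1/2) *\<^sub>R Q t) (bracket_deriv T X XX t)"
    if "t \<in> {0..T}" for t
    using that by (simp_all add: Z_eqs(3-) dF'Y' ddFY'Y' a_def tensor_transpose_conv_swap)
  have P_tens: "blinfun_apply (P t) (v \<otimes> w) = blinfun_apply (c t) (blinfun_apply (Y' t) v \<otimes> w)"
    and Q_tens: "blinfun_apply (Q t) (v \<otimes> w) =
      blinfun_apply (e t) (blinfun_apply (Y' t) v \<otimes> blinfun_apply (Y' t) w)" for t v w
    by (simp_all add: P_def Q_def)
  have Q_swap: "blinfun_apply (Q t) (blinfun_apply tensor_swap \<tau>) = blinfun_apply (Q t) \<tau>"
    if "t \<in> {0..T}" for t \<tau>
    unfolding Q_def e_def using fields that by (intro symmetric_map_tensor_map) auto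

  \<comment> \<open>Increments of \<open>Z''\<close> and \<open>Zd\<close>\<close>
  have "?O \<alpha> (\<lambda>s t. ((a t o\<^sub>L Y'' t) + F'' t (Y t) + P t + (P t o\<^sub>L tensor_swap) + Q t)
      - ((a s o\<^sub>L Y'' s) + F'' s (Y s) + P s + (P s o\<^sub>L tensor_swap) + Q s))"
    by (rule incr_order_increment_add[OF incr_order_increment_add[OF incr_order_increment_add[OF incr_order_increment_add[OF
        product_increment[OF comp a1 Y''1] F''1] P1] product_increment[OF comp P1 incr_order_increment_const]] Q1])
  then have Z''1: "?O \<alpha> (\<lambda>s t. Z'' t - Z'' s)"
    by (rule incr_order_cong[THEN iffD2, rotated]) (simp add: Z)
  have "?O \<alpha> (\<lambda>s t. (blinfun_apply (a t) (Yd t) + Fd t (Y t)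
        + blinfun_apply (P t + (1/2) *\<^sub>R Q t) (bracket_deriv T X XX t))
      - (blinfun_apply (a s) (Yd s) + Fd s (Y s)
        + blinfun_apply (P s + (1/2) *\<^sub>R Q s) (bracket_deriv T X XX s)))"
    by (rule incr_order_increment_add[OF incr_order_increment_add[OF product_increment[OF app a1 Yd1] Fd1]
        product_increment[OF app PQ1 incr_order_hoelder[OF hb]]])
  then have Zd1: "?O \<alpha> (\<lambda>s t. Zd t - Zd s)"
    by (rule incr_order_cong[THEN iffD2, rotated]) (simp add: Z)

  \<comment> \<open>Expansion of \<open>Z'\<close>\<close>
  have Z'2: "?O (2 * \<alpha>) (\<lambda>s t. Z' t - Z' s - partial_app (Z'' s) (?dX s t))"
  proof -
    \<comment> \<open>\<open>?R1\<close> and \<open>?R2\<close> are the field remainders of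
      \<open>F'\<close> and \<open>dF\<close>, and \<open>?R3\<close> is the remainder of
      \<open>Y'\<close>. \<open>?R4\<close> replaces \<open>a t\<close> by \<open>a s\<close> before
      the \<open>Y''\<close> term; \<open>?R5\<close> and \<open>?R6\<close> replace the increment
      of \<open>Y\<close> by \<open>Y'\<close> applied to that of \<open>X\<close>.\<close>
    let ?R1 = "\<lambda>s t. F' t (Y t) - (F' s (Y s) + partial_app (F'' s (Y s)) (?dX s t) + partial_app (c s) (?dY s t))"
    let ?R2 = "\<lambda>s t. (a t - (a s + partial_app (tensor_transpose (c s)) (?dX s t) + partial_app (e s) (?dY s t)))
      o\<^sub>L Y' s"
    let ?R3 = "\<lambda>s t. a t o\<^sub>L (Y' t - Y' s - partial_app (Y'' s) (?dX s t))"
    let ?R4 = "\<lambda>s t. (a t - a s) o\<^sub>L partial_app (Y'' s) (?dX s t)"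
    let ?R5 = "\<lambda>s t. partial_app (c s) (?dY s t - blinfun_apply (Y' s) (?dX s t))"
    let ?R6 = "\<lambda>s t. partial_app (e s) (?dY s t - blinfun_apply (Y' s) (?dX s t)) o\<^sub>L Y' s"
    have R2: "?O (2 * \<alpha>) ?R2" using incr_order_bilinear[OF comp dF2 Y'0] by simp
    have R3: "?O (2 * \<alpha>) ?R3" using incr_order_bilinear[OF comp a0(2) Y'2] by simp
    have R4: "?O (2 * \<alpha>) ?R4" using incr_order_bilinear[OF comp a1 pYX1] by simp
    have R5: "?O (2 * \<alpha>) ?R5" using incr_order_bilinear[OF pa c0 YR2] by simp
    have R6: "?O (2 * \<alpha>) ?R6"
      using incr_order_bilinear[OF comp incr_order_bilinear[OF pa e0 YR2] Y'0] by simp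
    have "?O (2 * \<alpha>) (\<lambda>s t. ?R1 s t + ?R2 s t + ?R3 s t + ?R4 s t + ?R5 s t + ?R6 s t)"
      by (intro incr_order_add F'2 R2 R3 R4 R5 R6)
    then show ?thesis
    proof (rule incr_order_cong[THEN iffD2, rotated])
      fix s t assume "0 \<le> s" "s < t" "t \<le> T"
      then have st: "s \<in> {0..T}" "t \<in> {0..T}" by auto
      \<comment> \<open>The transposed mixed term in \<open>?R2\<close>, composed with
        \<open>Y' s\<close>, is exactly the contribution of
        \<open>P s o\<^sub>L tensor_swap\<close>.\<close>
      show "Z' t - Z' s - partial_app (Z'' s) (?dX s t) =
          ?R1 s t + ?R2 s t + ?R3 s t + ?R4 s t + ?R5 s t + ?R6 s t"
        unfolding Z(2,3)[OF st(1)] Z(2,3)[OF st(2)] tensor_transpose_conv_swap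
        by (rule blinfun_eqI)
          (simp add: blinfun.bilinear_simps P_tens Q_tens tn.diff_left)
    qed
  qed

  \<comment> \<open>Expansion of \<open>Z\<close>\<close>
  have Z3: "?O (3 * \<alpha>) (\<lambda>s t. Z t - Z s - blinfun_apply (Z' s) (?dX s t) - blinfun_apply (Z'' s) (XX s t)
           - (t - s) *\<^sub>R Zd s)"
  proof -
    let ?B = "\<lambda>s t. bracket X XX s t - (t - s) *\<^sub>R bracket_deriv T X XX s"
    let ?D = "\<lambda>s t. ?dY s t - blinfun_apply (Y' s) (?dX s t)"
    let ?R1 = "\<lambda>s t. F t (Y t) - (F s (Y s) + blinfun_apply (F' s (Y s)) (?dX s t)
            + blinfun_apply (a s) (?dY s t) + blinfun_apply (F'' s (Y s)) (XX s t)
            + blinfun_apply (c s) (?dY s t \<otimes> ?dX s t)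
            + (1/2) *\<^sub>R blinfun_apply (e s) (?dY s t \<otimes> ?dY s t)
            + (t - s) *\<^sub>R Fd s (Y s))"
    \<comment> \<open>The first-order term needs the full remainder of \<open>Y\<close>, since
      \<open>a s\<close> is only bounded and supplies no extra order.\<close>
    let ?R2 = "\<lambda>s t. blinfun_apply (a s) (?dY s t - blinfun_apply (Y' s) (?dX s t)
      - blinfun_apply (Y'' s) (XX s t) - (t - s) *\<^sub>R Yd s)"
    let ?R3 = "\<lambda>s t. blinfun_apply (c s) (?D s t \<otimes> ?dX s t)"
    \<comment> \<open>\<open>?R4\<close> and \<open>?R5\<close> telescope: changing one tensor
      factor at a time turns the square of the increment of \<open>Y\<close> into the square of
      \<open>Y'\<close> applied to the increment of \<open>X\<close>.\<close>
    let ?R4 = "\<lambda>s t. (1/2) *\<^sub>R blinfun_apply (e s) (?D s t \<otimes> ?dY s t)"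
    let ?R5 = "\<lambda>s t. (1/2) *\<^sub>R blinfun_apply (e s) (blinfun_apply (Y' s) (?dX s t) \<otimes> ?D s t)"
    let ?R6 = "\<lambda>s t. blinfun_apply (P s + (1/2) *\<^sub>R Q s) (?B s t)"
    have R2: "?O (3 * \<alpha>) ?R2" using incr_order_bilinear[OF app a0(1) Y3] by simp
    have R3: "?O (3 * \<alpha>) ?R3"
      using incr_order_bilinear[OF app c0 incr_order_bilinear[OF tens YR2 X1]] by simp
    have R4: "?O (3 * \<alpha>) ?R4"
      using incr_order_scaleR[OF incr_order_bilinear[OF app e0 incr_order_bilinear[OF tens YR2 Y1]]] by simp
    have R5: "?O (3 * \<alpha>) ?R5"
      using incr_order_scaleR[OF incr_order_bilinear[OF app e0 incr_order_bilinear[OF tens Y'X1 YR2]]] by simp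
    \<comment> \<open>The linearization error has order \<open>1 + \<alpha>\<close>, which is at
      least \<open>3 * \<alpha>\<close> because \<open>\<alpha> \<le> 1/2\<close>.\<close>
    have "?O (3 * \<alpha>) ?B"
      by (rule incr_order_mono[OF incr_order_bracket_linearization[OF assms(4)]]) (use \<alpha> in auto)
    from incr_order_bilinear[OF app incr_order_bounded(1)[OF PQ1 less_imp_le[OF \<alpha>(1)]] this]
    have R6: "?O (3 * \<alpha>) ?R6" by (simp only: add_0)
    have "?O (3 * \<alpha>) (\<lambda>s t. ?R1 s t + ?R2 s t + ?R3 s t + ?R4 s t + ?R5 s t + ?R6 s t)"
      by (intro incr_order_add F3 R2 R3 R4 R5 R6)
    then show ?thesis
    proof (rule incr_order_cong[THEN iffD2, rotated])
      fix s t assume "0 \<le> s" "s < t" "t \<le> T"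
      then have st: "s \<in> {0..T}" "t \<in> {0..T}" by auto
      \<comment> \<open>On the symmetrised second level, \<open>Q_swap\<close> turns
        \<open>(1/2) *\<^sub>R Q s\<close> into one full copy of \<open>Q s\<close>, while
        \<open>P s\<close> leaves itself and its transpose. These are the last three terms of
        \<open>Z''\<close>.\<close>
      have "blinfun_apply (P s + (1/2) *\<^sub>R Q s) (bracket X XX s t) =
          blinfun_apply (c s) (blinfun_apply (Y' s) (?dX s t) \<otimes> ?dX s t)
          + (1/2) *\<^sub>R blinfun_apply (e s) (blinfun_apply (Y' s) (?dX s t) \<otimes> blinfun_apply (Y' s) (?dX s t))
          - (blinfun_apply (P s) (XX s t) + blinfun_apply (P s o\<^sub>L tensor_swap) (XX s t)
             + blinfun_apply (Q s) (XX s t))"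
        unfolding bracket_conv_swap
        by (simp add: blinfun.add_left blinfun.add_right blinfun.diff_right blinfun.scaleR_left P_tens Q_tens
            Q_swap[OF st(1)] flip: scaleR_add_left)
      then show "Z t - Z s - blinfun_apply (Z' s) (?dX s t) - blinfun_apply (Z'' s) (XX s t) - (t - s) *\<^sub>R Zd s =
          ?R1 s t + ?R2 s t + ?R3 s t + ?R4 s t + ?R5 s t + ?R6 s t"
        unfolding Z[OF st(1)] Z(1)[OF st(2)] blinfun.diff_right[of "P s + (1/2) *\<^sub>R Q s"]
        by (simp add: blinfun.add_left blinfun.diff_right blinfun.scaleR_right tn.diff_left tn.diff_right
            scaleR_add_right scaleR_diff_right)
    qed
  qed

  show ?thesis
    unfolding strongly_controlled_iff_incr_order using Z3 Z'2 Z''1 Zd1 by blast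
qed

end
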